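(* Let $I\subseteq\mathbb R$ be an interval of nonzero length with $a=\inf I=-\infty$, let $1\le k\le n+1$, and let $\mathcal G$ be any set with $\mathcal P_+^{k:n}\cup\mathcal P^+_{0:n}\subseteq\mathcal G\subseteq\mathcal F_+^{k:n}$ (unit-gauges case $w_0=w_1=\dots=1$). Take any $(\nu_1,\nu_2)\in\mathrm N_+(\mathcal G)\times\mathrm N_+(\mathcal G)$ and any real $s$ and $z$. Then $(\nu_1,\nu_2)\in\hat{\mathcal G}$ if and only if all of the following conditions hold: (i) $\int_I(x-s)^i\,\nu_1(dx)=\int_I(x-s)^i\,\nu_2(dx)\in\mathbb R$ for all $i\in\{0,\dots,k-1\}$; (ii) $\int_I(x-z)^k\,\nu_1(dx)\ge\int_I(x-z)^k\,\nu_2(dx)$ if $k\le n$; (iii) $\int_I(x-t)_+^n\,\nu_1(dx)\ge\int_I(x-t)_+^n\,\nu_2(dx)$ for all $t\in I$.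
   Context: $k,n$ are nonnegative integers; $b=\sup I$. $\mathcal S^0$ is the set of Borel-measurable functions $I\to\mathbb R$. For $n\ge1$, $\mathcal S^n$ is the set of $(n-1)$-times differentiable functions $f:I\to\mathbb R$ such that $f^{(n-1)}$ is an indefinite integral, $f^{(n-1)}(x)=f^{(n-1)}(z)+\int_z^x f^{(n)}(u)\,du$ for all $x,z\in I$, of a (unique) function denoted $f^{(n)}$ that is right-continuous on $I\setminus\{b\}$ and, if $b\in I$, left-continuous at $b$; $f^{(0)}=f$ and $f^{(j)}$ for $j\le n-1$ is the usual derivative. $\mathcal F_+^{k:n}$ is the set of $f\in\mathcal S^n$ such that $f^{(j)}$ is nondecreasing on $I$ for each $j\in\{k-1,\dots,n\}$. $\mathcal P_+^{k:n}$ is the set of (restrictions to $I$ of) polynomials of degree $\le n$ that belong to $\mathcal F_+^{k:n}$. $(x-t)_+^n=(\max(0,x-t))^n$ for $n\ge1$, and $(x-t)_+^0$ is understood as $1$ if $x\ge t$ and $0$ if $x<t$. $\mathcal P^+_{0:n}$ is the set of functions $I\ni x\mapsto (x-t)_+^n/n!$, $t\in I$. $\mathrm N_+$ is the set of all nonnegative (not necessarily finite) measures on the Borel $\sigma$-algebra over $I$. For Borel $f$ and $\nu\in\mathrm N_+$, $\nu(f)=\int_I f\,d\nu=\nu(f_+)-\nu(f_-)$, which exists if at least one of $\nu(f_+),\nu(f_-)$ is finite; any stated condition on an integral means that the integral exists (in $[-\infty,\infty]$) and satisfies the condition. $\mathrm N_+(\mathcal G)=\{\nu\in\mathrm N_+:\nu(f)>-\infty\text{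 for all }f\in\mathcal G\}$. $\hat{\mathcal G}=\{(\nu_1,\nu_2)\in\mathrm N_+(\mathcal G)\times\mathrm N_+(\mathcal G):\nu_1(f)\ge\nu_2(f)\text{ for all }f\in\mathcal G\}$. *)

theory Defs
  imports "HOL-Analysis.Analysis" "HOL-Computational_Algebra.Polynomial"
begin

text \<open>
  Functions \<open>I \<rightarrow> \<real>\<close> are modelled as elements of \<^term>\<open>extensional I\<close>, so that
  a set of such functions is determined by the values of its members on \<open>I\<close>.
\<close>

definition right_end :: "real set \<Rightarrow> ereal" where
  "right_end I = (SUP x\<in>I. ereal x)"

text \<open>
  \<open>is_derivs I n f D\<close>: the function \<open>f\<close> is in the class \<open>S\<^sup>n\<close> and its derivatives
  \<open>f\<^sup>(\<^sup>0\<^sup>), \<dots>, f\<^sup>(\<^sup>n\<^sup>)\<close> on \<open>I\<close> are \<open>D 0, \<dots>, D n\<close>. Derivatives are taken within \<open>I\<close>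
  (one-sided at an endpoint). On a nondegenerate interval they are unique, see
  \<open>is_derivs_unique\<close> below.
\<close>

definition is_indef_integral :: "real set \<Rightarrow> (real \<Rightarrow> real) \<Rightarrow> (real \<Rightarrow> real) \<Rightarrow> bool" where
  "is_indef_integral I F g \<longleftrightarrow>
     (\<forall>x\<in>I. \<forall>z\<in>I. interval_lebesgue_integrable lborel (ereal z) (ereal x) g \<and>
                   F x = F z + (LBINT u=ereal z..ereal x. g u))"

definition one_sided_cont :: "real set \<Rightarrow> (real \<Rightarrow> real) \<Rightarrow> bool" where
  "one_sided_cont I g \<longleftrightarrow>
     (\<forall>x\<in>I. if ereal x = right_end I then continuous (at_left x) g else continuous (at_right x) g)"

definition is_derivs :: "real set \<Rightarrow> nat \<Rightarrow> (real \<Rightarrow> real) \<Rightarrow> (nat \<Rightarrow> real \<Rightarrow> real) \<Rightarrow> bool" where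
  "is_derivs I n f D \<longleftrightarrow>
     (\<forall>x\<in>I. D 0 x = f x) \<and>
     (if n = 0 then f \<in> borel_measurable (restrict_space borel I)
      else (\<forall>j. Suc j < n \<longrightarrow>
              (\<forall>x\<in>I. (D j has_real_derivative D (Suc j) x) (at x within I))) \<and>
           is_indef_integral I (D (n - 1)) (D n) \<and> one_sided_cont I (D n))"

definition S_class :: "real set \<Rightarrow> nat \<Rightarrow> (real \<Rightarrow> real) set" where
  "S_class I n = {f \<in> extensional I. \<exists>D. is_derivs I n f D}"

text \<open>Meant for \<open>k \<ge> 1\<close>; note that \<open>k - 1\<close> is truncated for \<open>k = 0\<close>.\<close>

definition F_plus :: "real set \<Rightarrow> nat \<Rightarrow> nat \<Rightarrow> (real \<Rightarrow> real) set" where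
  "F_plus I k n =
     {f \<in> S_class I n. \<exists>D. is_derivs I n f D \<and> (\<forall>j\<in>{k - 1..n}. mono_on I (D j))}"

definition P_plus :: "real set \<Rightarrow> nat \<Rightarrow> nat \<Rightarrow> (real \<Rightarrow> real) set" where
  "P_plus I k n = {restrict (poly p) I |p. degree p \<le> n} \<inter> F_plus I k n"

definition trunc_power :: "nat \<Rightarrow> real \<Rightarrow> real \<Rightarrow> real" where
  "trunc_power n t x = (if n = 0 then (if t \<le> x then 1 else 0) else (max 0 (x - t)) ^ n)"

definition P0_plus :: "real set \<Rightarrow> nat \<Rightarrow> (real \<Rightarrow> real) set" where
  "P0_plus I n = {restrict (\<lambda>x. trunc_power n t x / fact n) I |t. t \<in> I}"

definition N_plus :: "real set \<Rightarrow> real measure set" where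
  "N_plus I = {\<nu>. sets \<nu> = sets (restrict_space borel I)}"

text \<open>
  Since \<^const>\<open>ennreal\<close> maps negative reals to \<open>0\<close>, the two integrals below are
  those of the positive and negative parts of \<open>f\<close>. The value \<open>ext_integral \<nu> f\<close> is
  meaningful only if \<open>ext_integral_exists \<nu> f\<close>.
\<close>

definition ext_integral_exists :: "real measure \<Rightarrow> (real \<Rightarrow> real) \<Rightarrow> bool" where
  "ext_integral_exists \<nu> f \<longleftrightarrow>
     (\<integral>\<^sup>+ x. ennreal (f x) \<partial>\<nu>) < \<infinity> \<or> (\<integral>\<^sup>+ x. ennreal (- f x) \<partial>\<nu>) < \<infinity>"

definition ext_integral :: "real measure \<Rightarrow> (real \<Rightarrow> real) \<Rightarrow> ereal" where
  "ext_integral \<nu> f =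
     enn2ereal (\<integral>\<^sup>+ x. ennreal (f x) \<partial>\<nu>) - enn2ereal (\<integral>\<^sup>+ x. ennreal (- f x) \<partial>\<nu>)"

definition ext_integral_ge :: "real measure \<Rightarrow> real measure \<Rightarrow> (real \<Rightarrow> real) \<Rightarrow> bool" where
  "ext_integral_ge \<nu>1 \<nu>2 f \<longleftrightarrow>
     ext_integral_exists \<nu>1 f \<and> ext_integral_exists \<nu>2 f \<and> ext_integral \<nu>1 f \<ge> ext_integral \<nu>2 f"

definition ext_integral_eq_finite :: "real measure \<Rightarrow> real measure \<Rightarrow> (real \<Rightarrow> real) \<Rightarrow> bool" where
  "ext_integral_eq_finite \<nu>1 \<nu>2 f \<longleftrightarrow>
     ext_integral_exists \<nu>1 f \<and> ext_integral_exists \<nu>2 f \<and>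
     ext_integral \<nu>1 f = ext_integral \<nu>2 f \<and> \<bar>ext_integral \<nu>1 f\<bar> \<noteq> \<infinity>"

definition N_plus_of :: "real set \<Rightarrow> (real \<Rightarrow> real) set \<Rightarrow> real measure set" where
  "N_plus_of I G =
     {\<nu> \<in> N_plus I. \<forall>f\<in>G. ext_integral_exists \<nu> f \<and> ext_integral \<nu> f > -\<infinity>}"

definition hat :: "real set \<Rightarrow> (real \<Rightarrow> real) set \<Rightarrow> (real measure \<times> real measure) set" where
  "hat I G =
     {(\<nu>1, \<nu>2) \<in> N_plus_of I G \<times> N_plus_of I G. \<forall>f\<in>G. ext_integral_ge \<nu>1 \<nu>2 f}"

lemma indef_integral_density_unique:
  assumes I: "is_interval I" "\<exists>x\<in>I. \<exists>y\<in>I. x < y"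
    and FG: "\<And>x. x \<in> I \<Longrightarrow> F x = G x"
    and g: "is_indef_integral I F g" "one_sided_cont I g"
    and h: "is_indef_integral I G h" "one_sided_cont I h"
    and x: "x \<in> I"
  shows "g x = h x"
proof (rule ccontr)
  assume neq: "g x \<noteq> h x"
  define d where "d = (\<lambda>u. g u - h u)"
  have int0: "interval_lebesgue_integrable lborel (ereal p) (ereal q) d"
       "(LBINT u=ereal p..ereal q. d u) = 0" if "p \<in> I" "q \<in> I" for p q
  proof -
    have i: "interval_lebesgue_integrable lborel (ereal p) (ereal q) g"
         "interval_lebesgue_integrable lborel (ereal p) (ereal q) h"
      and e: "F q = F p + (LBINT u=ereal p..ereal q. g u)"
         "G q = G p + (LBINT u=ereal p..ereal q. h u)"
      using g(1) h(1) that unfolding is_indef_integral_def by blast+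
    show "interval_lebesgue_integrable lborel (ereal p) (ereal q) d"
      unfolding d_def using i by (rule interval_lebesgue_integral_diff)
    have "(LBINT u=ereal p..ereal q. d u)
          = (LBINT u=ereal p..ereal q. g u) - (LBINT u=ereal p..ereal q. h u)"
      unfolding d_def using i by (rule interval_lebesgue_integral_diff)
    thus "(LBINT u=ereal p..ereal q. d u) = 0" using e FG that by simp
  qed
  have key: False if pq: "p \<in> I" "q \<in> I" "p < q" and c: "c * d x > 0"
      and ge: "\<And>u. p < u \<Longrightarrow> u < q \<Longrightarrow> c * d u > c * d x / 2" for p q c
  proof -
    have *: "set_integrable lborel {p<..<q} d" "(LINT u:{p<..<q}|lborel. d u) = 0"
      using int0[OF pq(1,2)] pq(3)
      by (auto simp: interval_lebesgue_integrable_def interval_lebesgue_integral_def)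
    have "(LINT u:{p<..<q}|lborel. c * d x / 2) \<le> (LINT u:{p<..<q}|lborel. c * d u)"
    proof (rule set_integral_mono)
      show "set_integrable lborel {p<..<q} (\<lambda>u. c * d x / 2)"
        unfolding set_integrable_def by (rule integrable_scaleR_left) (use pq(3) in \<open>auto intro!: integrable_real_indicator\<close>)
      show "set_integrable lborel {p<..<q} (\<lambda>u. c * d u)"
        using *(1) by (rule set_integrable_mult_right)
    qed (use ge in \<open>auto intro: less_imp_le\<close>)
    also have "\<dots> = 0" using * by simp
    finally have "(q - p) * (c * d x / 2) \<le> 0"
      using pq(3) by (simp add: set_lebesgue_integral_def algebra_simps)
    moreover have "(q - p) * (c * d x / 2) > 0" using c pq(3) by (intro mult_pos_pos) auto
    ultimately show False by linarith
  qed
  define c where "c = sgn (d x)"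
  have c: "c * d x > 0" using neq by (auto simp: c_def d_def sgn_if)
  show False
  proof (cases "ereal x = right_end I")
    case True
    have "continuous (at_left x) d"
      using g(2) h(2) x True unfolding one_sided_cont_def d_def
      by (auto intro!: continuous_diff)
    hence "((\<lambda>u. c * d u) \<longlongrightarrow> c * d x) (at_left x)"
      by (auto intro!: tendsto_mult simp: continuous_within)
    hence "eventually (\<lambda>u. c * d u > c * d x / 2) (at_left x)"
      by (rule order_tendstoD) (use c in auto)
    then obtain p0 where p0: "p0 < x" "\<And>u. p0 < u \<Longrightarrow> u < x \<Longrightarrow> c * d u > c * d x / 2"
      unfolding eventually_at_left_field by auto
    have le: "y \<le> x" if "y \<in> I" for y
    proof -
      have "ereal y \<le> ereal x"
        unfolding True right_end_def by (rule SUP_upper[OF that])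
      thus ?thesis by simp
    qed
    obtain p q where "p \<in> I" "q \<in> I" "p < q" using I(2) by blast
    hence "p \<in> I" "p < x" using le[of q] by auto
    then obtain y where y: "y \<in> I" "y < x" by blast
    have "max p0 y \<in> I" by (rule mem_is_interval_1_I[OF I(1) y(1) x]) (use y p0 in auto)
    thus False by (rule key[of _ x c]) (use x y p0 c in auto)
  next
    case False
    have "continuous (at_right x) d"
      using g(2) h(2) x False unfolding one_sided_cont_def d_def
      by (auto intro!: continuous_diff)
    hence "((\<lambda>u. c * d u) \<longlongrightarrow> c * d x) (at_right x)"
      by (auto intro!: tendsto_mult simp: continuous_within)
    hence "eventually (\<lambda>u. c * d u > c * d x / 2) (at_right x)"
      by (rule order_tendstoD) (use c in auto)
    then obtain p0 where p0: "p0 > x" "\<And>u. x < u \<Longrightarrow> u < p0 \<Longrightarrow> c * d u > c * d x / 2"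
      unfolding eventually_at_right_field by auto
    have "ereal x < right_end I"
      using False SUP_upper[OF x, of ereal] unfolding right_end_def by (simp add: order_less_le)
    then obtain y where y: "y \<in> I" "x < y"
      unfolding right_end_def less_SUP_iff by auto
    have "min p0 y \<in> I" by (rule mem_is_interval_1_I[OF I(1) x y(1)]) (use y p0 in auto)
    thus False by (rule key[of x _ c, rotated]) (use x y p0 c in auto)
  qed
qed

lemma is_derivs_unique:
  assumes I: "is_interval I" "\<exists>x\<in>I. \<exists>y\<in>I. x < y"
    and D: "is_derivs I n f D" and E: "is_derivs I n f E"
    and "j \<le> n" "x \<in> I"
  shows "D j x = E j x"
proof -
  have nt: "at x within I \<noteq> bot" if "x \<in> I" for x
  proof -
    obtain p q where pq: "p \<in> I" "q \<in> I" "p < q" using I(2) by blast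
    have "connected I" using I(1) by (simp add: is_interval_connected_1)
    moreover have "I \<noteq> {x}" using pq by auto
    ultimately have "x islimpt I" using that by (auto intro: connected_imp_perfect)
    thus ?thesis by (simp add: trivial_limit_within)
  qed
  have low: "\<forall>x\<in>I. D j x = E j x" if "j < n \<or> j = 0" for j
    using that
  proof (induction j)
    case 0
    thus ?case using D E by (auto simp: is_derivs_def)
  next
    case (Suc j)
    hence j: "Suc j < n" by auto
    show ?case
    proof
      fix x assume x: "x \<in> I"
      have 1: "(D j has_real_derivative D (Suc j) x) (at x within I)"
        and 2: "(E j has_real_derivative E (Suc j) x) (at x within I)"
        using D E j x by (auto simp: is_derivs_def split: if_splits)
      have eq: "\<And>y. y \<in> I \<Longrightarrow> D j y = E j y" using Suc j by auto
      have 3: "(E j has_real_derivative D (Suc j) x) (at x within I)"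
        using has_field_derivative_transform_within[OF 1 zero_less_one x] eq by blast
      show "D (Suc j) x = E (Suc j) x"
        using 2 3 tendsto_unique[OF nt[OF x]] unfolding has_field_derivative_iff by blast
    qed
  qed
  show ?thesis
  proof (cases "j < n \<or> j = 0")
    case True thus ?thesis using low \<open>x \<in> I\<close> by auto
  next
    case False
    hence j: "j = n" "n \<noteq> 0" using \<open>j \<le> n\<close> by auto
    have "\<And>x. x \<in> I \<Longrightarrow> D (n - 1) x = E (n - 1) x" using low[of "n - 1"] j by auto
    thus ?thesis
      using indef_integral_density_unique[OF I, of "D (n-1)" "E (n-1)" "D n" "E n" x] D E j \<open>x \<in> I\<close>
      by (auto simp: is_derivs_def)
  qed
qed

end

theory Submission
  imports Defs
begin

text \<open>
  Conditions (i) and (ii) say that \<open>\<nu>\<^sub>1(p) \<ge> \<nu>\<^sub>2(p)\<close> for every polynomial \<open>p\<close> of degree at most \<open>k\<close> (and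
  at most \<open>n\<close>) with nonnegative coefficient at \<open>x\<^sup>k\<close>, with equality in degrees below \<open>k\<close>; these \<open>p\<close>
  lie in \<open>P\<^sub>+\<close>, which settles necessity. For sufficiency, let \<open>g\<close> be the \<open>n\<close>-th derivative of \<open>f\<close> and
  \<open>t\<^sub>l = inf {x. l \<le> g x}\<close>. By the layer-cake formula \<open>g\<close> is a constant plus an integral over the
  levels \<open>l\<close> of the step functions \<open>(x - t\<^sub>l)\<^sub>+\<^sup>0\<close>. Integrating from \<open>-\<infinity>\<close> down to order \<open>k\<close>, where
  nonnegativity of the derivatives kills all constants but the last, and then from a base point \<open>s\<close> in \<open>I\<close>,
  writes \<open>f\<close> as \<open>T(x) + \<integral> H(l, x) dl\<close> with \<open>T\<close> a polynomial as above and \<open>H(l, x)\<close> equal to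
  \<open>(x - t\<^sub>l)\<^sub>+\<^sup>n / n!\<close> minus a polynomial of degree below \<open>k\<close>. The sign of \<open>H(l, x)\<close> depends only on \<open>x\<close>
  (nonnegative right of \<open>s\<close>, that of \<open>(-1)\<^sup>k\<close> left of \<open>s\<close>), so the positive and negative parts of the
  integral are integrals of the parts of \<open>H\<close>, and Tonelli's theorem reduces the claim to (iii).
\<close>

subsection \<open>Comparison of extended integrals\<close>

text \<open>The inequality of the integrals with the negative parts moved across, so that no \<open>\<infinity> - \<infinity>\<close> can occur.\<close>

definition int_ge :: "real measure \<Rightarrow> real measure \<Rightarrow> (real \<Rightarrow> real) \<Rightarrow> bool" where
  "int_ge \<nu>1 \<nu>2 f \<longleftrightarrow>
     f \<in> borel_measurable \<nu>1 \<and> f \<in> borel_measurable \<nu>2 \<and>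
     (\<integral>\<^sup>+x. ennreal (- f x) \<partial>\<nu>1) < \<infinity> \<and> (\<integral>\<^sup>+x. ennreal (- f x) \<partial>\<nu>2) < \<infinity> \<and>
     (\<integral>\<^sup>+x. ennreal (f x) \<partial>\<nu>2) + (\<integral>\<^sup>+x. ennreal (- f x) \<partial>\<nu>1)
       \<le> (\<integral>\<^sup>+x. ennreal (f x) \<partial>\<nu>1) + (\<integral>\<^sup>+x. ennreal (- f x) \<partial>\<nu>2)"

lemma enn2ereal_diff_le_iff:
  assumes "b < \<infinity>" "d < \<infinity>"
  shows "enn2ereal c - enn2ereal d \<le> enn2ereal a - enn2ereal b \<longleftrightarrow> c + b \<le> a + d"
proof -
  obtain b' where b: "b = ennreal b'" "b' \<ge> 0" using assms(1) by (cases b) auto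
  obtain d' where d: "d = ennreal d'" "d' \<ge> 0" using assms(2) by (cases d) auto
  show ?thesis
    by (cases a; cases c) (auto simp: b d enn2ereal_ennreal top_unique ennreal_plus[symmetric] simp del: ennreal_plus)
qed

lemma ext_integral_ge_iff_int_ge:
  assumes "f \<in> borel_measurable \<nu>1" "f \<in> borel_measurable \<nu>2"
    and "(\<integral>\<^sup>+x. ennreal (- f x) \<partial>\<nu>1) < \<infinity>" "(\<integral>\<^sup>+x. ennreal (- f x) \<partial>\<nu>2) < \<infinity>"
  shows "ext_integral_ge \<nu>1 \<nu>2 f \<longleftrightarrow> int_ge \<nu>1 \<nu>2 f"
  using assms enn2ereal_diff_le_iff[OF assms(3,4)]
  by (auto simp: ext_integral_ge_def ext_integral_exists_def ext_integral_def int_ge_def)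

lemma neg_part_finite_if_ext_integral:
  assumes "ext_integral_exists \<nu> f" "ext_integral \<nu> f > -\<infinity>"
  shows "(\<integral>\<^sup>+x. ennreal (- f x) \<partial>\<nu>) < \<infinity>"
proof (rule ccontr)
  assume "\<not> ?thesis"
  then have inf: "(\<integral>\<^sup>+x. ennreal (- f x) \<partial>\<nu>) = \<infinity>" by (metis less_top infinity_ennreal_def)
  with assms(1) have "(\<integral>\<^sup>+x. ennreal (f x) \<partial>\<nu>) < \<infinity>" by (simp add: ext_integral_exists_def)
  then obtain p where "(\<integral>\<^sup>+x. ennreal (f x) \<partial>\<nu>) = ennreal p" "p \<ge> 0"
    by (cases "\<integral>\<^sup>+x. ennreal (f x) \<partial>\<nu>") auto
  with inf assms(2) show False by (simp add: ext_integral_def enn2ereal_ennreal)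
qed

lemma pos_part_finite_if_ext_integral:
  assumes "ext_integral_exists \<nu> f" "ext_integral \<nu> f < \<infinity>"
  shows "(\<integral>\<^sup>+x. ennreal (f x) \<partial>\<nu>) < \<infinity>"
proof (rule ccontr)
  assume "\<not> ?thesis"
  then have inf: "(\<integral>\<^sup>+x. ennreal (f x) \<partial>\<nu>) = \<infinity>" by (metis less_top infinity_ennreal_def)
  with assms(1) have "(\<integral>\<^sup>+x. ennreal (- f x) \<partial>\<nu>) < \<infinity>" by (simp add: ext_integral_exists_def)
  then obtain p where "(\<integral>\<^sup>+x. ennreal (- f x) \<partial>\<nu>) = ennreal p" "p \<ge> 0"
    by (cases "\<integral>\<^sup>+x. ennreal (- f x) \<partial>\<nu>") auto
  with inf assms(2) show False by (simp add: ext_integral_def enn2ereal_ennreal)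
qed

lemma ext_integral_cong:
  assumes "\<And>x. x \<in> space \<nu> \<Longrightarrow> f x = g x"
  shows "ext_integral \<nu> f = ext_integral \<nu> g" "ext_integral_exists \<nu> f = ext_integral_exists \<nu> g"
  using nn_integral_cong[of \<nu> "\<lambda>x. ennreal (f x)" "\<lambda>x. ennreal (g x)"]
    nn_integral_cong[of \<nu> "\<lambda>x. ennreal (- f x)" "\<lambda>x. ennreal (- g x)"] assms
  by (simp_all add: ext_integral_def ext_integral_exists_def)

text \<open>This integrates the pointwise identity between \<open>f\<close>, \<open>g\<close>,
  \<open>f + g\<close> and their positive and negative parts. The form without subtraction stays
  valid when any of the six integrals is infinite.\<close>

lemma nn_integral_add_parts:
  assumes [measurable]: "f \<in> borel_measurable \<nu>" "g \<in> borel_measurable \<nu>"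
  shows "(\<integral>\<^sup>+x. ennreal (f x + g x) \<partial>\<nu>) + ((\<integral>\<^sup>+x. ennreal (- f x) \<partial>\<nu>) + (\<integral>\<^sup>+x. ennreal (- g x) \<partial>\<nu>))
       = (\<integral>\<^sup>+x. ennreal (- (f x + g x)) \<partial>\<nu>) + ((\<integral>\<^sup>+x. ennreal (f x) \<partial>\<nu>) + (\<integral>\<^sup>+x. ennreal (g x) \<partial>\<nu>))"
proof -
  \<comment> \<open>\<open>ennreal_plus\<close> needs nonnegative summands; inserting
    \<open>max 0\<close> makes the truncation explicit and the claim a real identity.\<close>
  have e: "ennreal r = ennreal (max 0 r)" for r by (simp add: max_def ennreal_neg)
  have pt: "ennreal (a + b) + (ennreal (- a) + ennreal (- b))
          = ennreal (- (a + b)) + (ennreal a + ennreal b)" for a b :: real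
  proof -
    have "ennreal (a + b) + (ennreal (- a) + ennreal (- b))
        = ennreal (max 0 (a + b)) + (ennreal (max 0 (- a)) + ennreal (max 0 (- b)))"
      by (simp only: e[symmetric])
    also have "\<dots> = ennreal (max 0 (a + b) + (max 0 (- a) + max 0 (- b)))"
      by (simp only: ennreal_plus max.cobounded1 add_nonneg_nonneg)
    also have "max 0 (a + b) + (max 0 (- a) + max 0 (- b)) = max 0 (- (a + b)) + (max 0 a + max 0 b)"
      by (auto simp: max_def)
    also have "ennreal (max 0 (- (a + b)) + (max 0 a + max 0 b))
        = ennreal (max 0 (- (a + b))) + (ennreal (max 0 a) + ennreal (max 0 b))"
      by (simp only: ennreal_plus max.cobounded1 add_nonneg_nonneg)
    also have "\<dots> = ennreal (- (a + b)) + (ennreal a + ennreal b)"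
      by (simp only: e[symmetric])
    finally show ?thesis .
  qed
  have "(\<integral>\<^sup>+x. ennreal (f x + g x) \<partial>\<nu>) + ((\<integral>\<^sup>+x. ennreal (- f x) \<partial>\<nu>) + (\<integral>\<^sup>+x. ennreal (- g x) \<partial>\<nu>))
      = (\<integral>\<^sup>+x. ennreal (f x + g x) + (ennreal (- f x) + ennreal (- g x)) \<partial>\<nu>)"
    by (simp add: nn_integral_add)
  also have "\<dots> = (\<integral>\<^sup>+x. ennreal (- (f x + g x)) + (ennreal (f x) + ennreal (g x)) \<partial>\<nu>)"
    unfolding pt ..
  also have "\<dots> = (\<integral>\<^sup>+x. ennreal (- (f x + g x)) \<partial>\<nu>) + ((\<integral>\<^sup>+x. ennreal (f x) \<partial>\<nu>) + (\<integral>\<^sup>+x. ennreal (g x) \<partial>\<nu>))"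
    by (simp add: nn_integral_add del: minus_add_distrib)
  finally show ?thesis .
qed

lemma neg_part_add_le:
  assumes [measurable]: "f \<in> borel_measurable \<nu>" "g \<in> borel_measurable \<nu>"
  shows "(\<integral>\<^sup>+x. ennreal (- (f x + g x)) \<partial>\<nu>)
       \<le> (\<integral>\<^sup>+x. ennreal (- f x) \<partial>\<nu>) + (\<integral>\<^sup>+x. ennreal (- g x) \<partial>\<nu>)"
proof -
  have pt: "ennreal (- (a + b)) \<le> ennreal (- a) + ennreal (- b)" for a b :: real
  proof -
    have "ennreal (- (a + b)) \<le> ennreal (max 0 (- a) + max 0 (- b))" by (intro ennreal_leI) simp
    also have "\<dots> = ennreal (- a) + ennreal (- b)"
      by (subst ennreal_plus) (auto simp: max_def ennreal_neg)
    finally show ?thesis .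
  qed
  show ?thesis
    by (subst nn_integral_add[symmetric], measurable, rule nn_integral_mono, rule pt)
qed

lemma int_ge_add:
  assumes f: "int_ge \<nu>1 \<nu>2 f" and g: "int_ge \<nu>1 \<nu>2 g"
  shows "int_ge \<nu>1 \<nu>2 (\<lambda>x. f x + g x)"
proof -
  let ?p = "\<lambda>\<nu> f. \<integral>\<^sup>+x. ennreal (f x) \<partial>\<nu>" and ?s = "\<lambda>x. f x + g x"
  let ?m = "\<lambda>\<nu> f. \<integral>\<^sup>+x. ennreal (- f x) \<partial>\<nu>"
  have [measurable]: "f \<in> borel_measurable \<nu>1" "g \<in> borel_measurable \<nu>1"
    "f \<in> borel_measurable \<nu>2" "g \<in> borel_measurable \<nu>2"
    using f g by (auto simp: int_ge_def)
  have fin: "?m \<nu>1 f < \<infinity>" "?m \<nu>2 f < \<infinity>" "?m \<nu>1 g < \<infinity>" "?m \<nu>2 g < \<infinity>"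
    using f g by (auto simp: int_ge_def)
  have fins: "?m \<nu>1 ?s < \<infinity>" "?m \<nu>2 ?s < \<infinity>"
    using neg_part_add_le[of f \<nu>1 g] neg_part_add_le[of f \<nu>2 g] fin
    by (auto intro: le_less_trans)
  \<comment> \<open>\<open>N\<close> collects the four negative parts. Adding it to both sides lets
    \<open>e1\<close> and \<open>e2\<close> trade the parts of the sum for those of \<open>f\<close>
    and \<open>g\<close>; being finite, it cancels at the end.\<close>
  define N where "N = (?m \<nu>1 f + ?m \<nu>1 g) + (?m \<nu>2 f + ?m \<nu>2 g)"
  have N: "N \<noteq> top" using fin by (simp add: N_def flip: less_top)
  have i: "?p \<nu>2 f + ?m \<nu>1 f \<le> ?p \<nu>1 f + ?m \<nu>2 f" "?p \<nu>2 g + ?m \<nu>1 g \<le> ?p \<nu>1 g + ?m \<nu>2 g"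
    using f g by (auto simp: int_ge_def)
  have e1: "?p \<nu>1 ?s + (?m \<nu>1 f + ?m \<nu>1 g) = ?m \<nu>1 ?s + (?p \<nu>1 f + ?p \<nu>1 g)"
    and e2: "?p \<nu>2 ?s + (?m \<nu>2 f + ?m \<nu>2 g) = ?m \<nu>2 ?s + (?p \<nu>2 f + ?p \<nu>2 g)"
    by (rule nn_integral_add_parts; measurable)+
  have "N + (?p \<nu>2 ?s + ?m \<nu>1 ?s)
      = (?p \<nu>2 ?s + (?m \<nu>2 f + ?m \<nu>2 g)) + (?m \<nu>1 f + ?m \<nu>1 g) + ?m \<nu>1 ?s"
    by (simp add: N_def ac_simps)
  also have "\<dots> = (?p \<nu>2 f + ?m \<nu>1 f) + (?p \<nu>2 g + ?m \<nu>1 g) + (?m \<nu>1 ?s + ?m \<nu>2 ?s)"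
    unfolding e2 by (simp add: ac_simps)
  also have "\<dots> \<le> (?p \<nu>1 f + ?m \<nu>2 f) + (?p \<nu>1 g + ?m \<nu>2 g) + (?m \<nu>1 ?s + ?m \<nu>2 ?s)"
    by (intro add_mono i order_refl)
  also have "\<dots> = (?m \<nu>1 ?s + (?p \<nu>1 f + ?p \<nu>1 g)) + (?m \<nu>2 f + ?m \<nu>2 g) + ?m \<nu>2 ?s"
    by (simp add: ac_simps)
  also have "\<dots> = N + (?p \<nu>1 ?s + ?m \<nu>2 ?s)"
    unfolding e1[symmetric] by (simp add: N_def ac_simps)
  finally have "?p \<nu>2 ?s + ?m \<nu>1 ?s \<le> ?p \<nu>1 ?s + ?m \<nu>2 ?s"
    using N by (simp add: ennreal_add_left_cancel_le)
  with fins show ?thesis unfolding int_ge_def by simp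
qed

lemma int_ge_cmult:
  assumes f: "int_ge \<nu>1 \<nu>2 f" and c: "c \<ge> 0"
  shows "int_ge \<nu>1 \<nu>2 (\<lambda>x. c * f x)"
proof -
  have [measurable]: "f \<in> borel_measurable \<nu>1" "f \<in> borel_measurable \<nu>2"
    using f by (auto simp: int_ge_def)
  have p: "(\<integral>\<^sup>+x. ennreal (c * f x) \<partial>\<nu>) = ennreal c * (\<integral>\<^sup>+x. ennreal (f x) \<partial>\<nu>)"
    and m: "(\<integral>\<^sup>+x. ennreal (- (c * f x)) \<partial>\<nu>) = ennreal c * (\<integral>\<^sup>+x. ennreal (- f x) \<partial>\<nu>)"
    if [measurable]: "f \<in> borel_measurable \<nu>" for \<nu> :: "real measure"
    using ennreal_mult'[OF c, of "f x" for x] ennreal_mult'[OF c, of "- f x" for x] by (simp_all add: nn_integral_cmult)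
  show ?thesis
    using f by (auto simp: int_ge_def p m ennreal_mult_less_top simp flip: distrib_left
      intro!: mult_left_mono)
qed

lemma int_ge_sum:
  assumes "finite A" "\<And>i. i \<in> A \<Longrightarrow> int_ge \<nu>1 \<nu>2 (f i)"
  shows "int_ge \<nu>1 \<nu>2 (\<lambda>x. \<Sum>i\<in>A. f i x)"
  using assms
proof (induction A rule: finite_induct)
  case empty
  then show ?case by (simp add: int_ge_def)
next
  case (insert i A)
  then show ?case by (simp add: int_ge_add)
qed

lemma int_ge_cong:
  assumes "space \<nu>1 = I" "space \<nu>2 = I" "\<And>x. x \<in> I \<Longrightarrow> f x = g x" "int_ge \<nu>1 \<nu>2 f"
  shows "int_ge \<nu>1 \<nu>2 g"
proof -
  have "f \<in> borel_measurable \<nu> \<longleftrightarrow> g \<in> borel_measurable \<nu>"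
    "(\<integral>\<^sup>+x. ennreal (f x) \<partial>\<nu>) = (\<integral>\<^sup>+x. ennreal (g x) \<partial>\<nu>)"
    "(\<integral>\<^sup>+x. ennreal (- f x) \<partial>\<nu>) = (\<integral>\<^sup>+x. ennreal (- g x) \<partial>\<nu>)"
    if "space \<nu> = I" for \<nu> :: "real measure"
    using assms(3) that by (auto intro!: measurable_cong nn_integral_cong)
  with assms(1,2,4) show ?thesis by (simp add: int_ge_def)
qed

text \<open>For fixed \<open>x\<close> all \<open>H l x\<close> have one sign, so truncation at 0
  commutes with integration over \<open>l\<close>: if the sign is negative, both sides are 0.
  Tonelli's theorem then swaps the integrals.\<close>

lemma nn_integral_mixture:
  fixes H :: "real \<Rightarrow> real \<Rightarrow> real"
  assumes \<nu>: "sigma_finite_measure \<nu>"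
    and H [measurable]: "case_prod H \<in> borel_measurable (lborel \<Otimes>\<^sub>M \<nu>)"
    and int: "\<And>x. x \<in> space \<nu> \<Longrightarrow> integrable lborel (\<lambda>l. H l x)"
    and sgn: "\<And>x. x \<in> space \<nu> \<Longrightarrow> (\<forall>l. 0 \<le> H l x) \<or> (\<forall>l. H l x \<le> 0)"
  shows "(\<integral>\<^sup>+x. ennreal (LINT l|lborel. H l x) \<partial>\<nu>) = (\<integral>\<^sup>+l. \<integral>\<^sup>+x. ennreal (H l x) \<partial>\<nu> \<partial>lborel)"
proof -
  interpret pair_sigma_finite lborel \<nu>
    unfolding pair_sigma_finite_def using \<nu> sigma_finite_lborel by blast
  have "(\<integral>\<^sup>+x. ennreal (LINT l|lborel. H l x) \<partial>\<nu>) = (\<integral>\<^sup>+x. \<integral>\<^sup>+l. ennreal (H l x) \<partial>lborel \<partial>\<nu>)"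
  proof (rule nn_integral_cong)
    fix x assume x: "x \<in> space \<nu>"
    from sgn[OF x] show "ennreal (LINT l|lborel. H l x) = (\<integral>\<^sup>+l. ennreal (H l x) \<partial>lborel)"
    proof
      assume "\<forall>l. 0 \<le> H l x"
      then show ?thesis using int[OF x] by (simp add: nn_integral_eq_integral)
    next
      assume neg: "\<forall>l. H l x \<le> 0"
      then have "(LINT l|lborel. H l x) \<le> 0"
        using integral_mono[OF int[OF x], of "\<lambda>_. 0"] by simp
      with neg show ?thesis by (simp add: ennreal_neg)
    qed
  qed
  also have "\<dots> = (\<integral>\<^sup>+l. \<integral>\<^sup>+x. ennreal (H l x) \<partial>\<nu> \<partial>lborel)"
    by (rule Fubini') measurable
  finally show ?thesis .
qed

text \<open>The mixture formula for \<open>H\<close> and for \<open>- H\<close> turns all four parts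
  into integrals over \<open>l\<close>, and \<open>ge\<close> is integrated level by level. Finite
  negative parts at each level need not give a finite integral over \<open>l\<close>, whence
  \<open>fin\<close>.\<close>

lemma int_ge_mixture:
  fixes H :: "real \<Rightarrow> real \<Rightarrow> real"
  assumes \<nu>: "sigma_finite_measure \<nu>1" "sigma_finite_measure \<nu>2" "space \<nu>1 = I" "space \<nu>2 = I"
    and H [measurable]: "case_prod H \<in> borel_measurable (lborel \<Otimes>\<^sub>M \<nu>1)"
      "case_prod H \<in> borel_measurable (lborel \<Otimes>\<^sub>M \<nu>2)"
    and int: "\<And>x. x \<in> I \<Longrightarrow> integrable lborel (\<lambda>l. H l x)"
    and sgn: "\<And>x. x \<in> I \<Longrightarrow> (\<forall>l. 0 \<le> H l x) \<or> (\<forall>l. H l x \<le> 0)"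
    and ge: "\<And>l. int_ge \<nu>1 \<nu>2 (H l)"
    and fin: "(\<integral>\<^sup>+x. ennreal (- (LINT l|lborel. H l x)) \<partial>\<nu>1) < \<infinity>"
       "(\<integral>\<^sup>+x. ennreal (- (LINT l|lborel. H l x)) \<partial>\<nu>2) < \<infinity>"
  shows "int_ge \<nu>1 \<nu>2 (\<lambda>x. LINT l|lborel. H l x)"
proof -
  have p: "(\<integral>\<^sup>+x. ennreal (LINT l|lborel. H l x) \<partial>\<nu>) = (\<integral>\<^sup>+l. \<integral>\<^sup>+x. ennreal (H l x) \<partial>\<nu> \<partial>lborel)"
    and m: "(\<integral>\<^sup>+x. ennreal (- (LINT l|lborel. H l x)) \<partial>\<nu>) = (\<integral>\<^sup>+l. \<integral>\<^sup>+x. ennreal (- H l x) \<partial>\<nu> \<partial>lborel)"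
    and mb: "(\<lambda>l. \<integral>\<^sup>+x. ennreal (H l x) \<partial>\<nu>) \<in> borel_measurable lborel"
      "(\<lambda>l. \<integral>\<^sup>+x. ennreal (- H l x) \<partial>\<nu>) \<in> borel_measurable lborel"
      "(\<lambda>x. LINT l|lborel. H l x) \<in> borel_measurable \<nu>"
    if \<nu>: "sigma_finite_measure \<nu>" "space \<nu> = I"
      and H [measurable]: "case_prod H \<in> borel_measurable (lborel \<Otimes>\<^sub>M \<nu>)" for \<nu> :: "real measure"
  proof -
    interpret sigma_finite_measure \<nu> by fact
    show "(\<integral>\<^sup>+x. ennreal (LINT l|lborel. H l x) \<partial>\<nu>) = (\<integral>\<^sup>+l. \<integral>\<^sup>+x. ennreal (H l x) \<partial>\<nu> \<partial>lborel)"
      by (rule nn_integral_mixture) (use that int sgn in auto)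
    have "(\<integral>\<^sup>+x. ennreal (LINT l|lborel. - H l x) \<partial>\<nu>) = (\<integral>\<^sup>+l. \<integral>\<^sup>+x. ennreal (- H l x) \<partial>\<nu> \<partial>lborel)"
    proof (rule nn_integral_mixture)
      have "(\<lambda>p. - case_prod H p) \<in> borel_measurable (lborel \<Otimes>\<^sub>M \<nu>)" by measurable
      then show "(\<lambda>(l, x). - H l x) \<in> borel_measurable (lborel \<Otimes>\<^sub>M \<nu>)" by (simp add: case_prod_unfold)
      show "(\<forall>l. 0 \<le> - H l x) \<or> (\<forall>l. - H l x \<le> 0)" if "x \<in> space \<nu>" for x
        using sgn[of x] that \<nu>(2) by auto
    qed (use that int in auto)
    then show "(\<integral>\<^sup>+x. ennreal (- (LINT l|lborel. H l x)) \<partial>\<nu>) = (\<integral>\<^sup>+l. \<integral>\<^sup>+x. ennreal (- H l x) \<partial>\<nu> \<partial>lborel)"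
      by simp
    show "(\<lambda>l. \<integral>\<^sup>+x. ennreal (H l x) \<partial>\<nu>) \<in> borel_measurable lborel"
      "(\<lambda>l. \<integral>\<^sup>+x. ennreal (- H l x) \<partial>\<nu>) \<in> borel_measurable lborel"
      by measurable
    show "(\<lambda>x. LINT l|lborel. H l x) \<in> borel_measurable \<nu>" by measurable
  qed
  note [simp] = p[OF \<nu>(1,3) H(1)] p[OF \<nu>(2,4) H(2)] m[OF \<nu>(1,3) H(1)] m[OF \<nu>(2,4) H(2)]
  note mb1 = mb[OF \<nu>(1,3) H(1)] and mb2 = mb[OF \<nu>(2,4) H(2)]
  have "(\<integral>\<^sup>+l. \<integral>\<^sup>+x. ennreal (H l x) \<partial>\<nu>2 \<partial>lborel) + (\<integral>\<^sup>+l. \<integral>\<^sup>+x. ennreal (- H l x) \<partial>\<nu>1 \<partial>lborel)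
     \<le> (\<integral>\<^sup>+l. \<integral>\<^sup>+x. ennreal (H l x) \<partial>\<nu>1 \<partial>lborel) + (\<integral>\<^sup>+l. \<integral>\<^sup>+x. ennreal (- H l x) \<partial>\<nu>2 \<partial>lborel)"
    using ge mb1(1,2) mb2(1,2)
    by (simp flip: nn_integral_add add: int_ge_def nn_integral_mono)
  then show ?thesis using fin mb1(3) mb2(3) by (simp add: int_ge_def)
qed

subsection \<open>Mixtures over a parameter\<close>

text \<open>The relation "F is an indefinite integral of f", stated with ordered endpoints to avoid
  oriented integrals. It covers differentiable \<open>F\<close> as well as densities with jumps,
  such as step functions.\<close>

definition increments_on :: "real set \<Rightarrow> (real \<Rightarrow> real) \<Rightarrow> (real \<Rightarrow> real) \<Rightarrow> bool" where
  "increments_on I F f \<longleftrightarrow> (\<forall>v\<in>I. \<forall>u\<in>I. v \<le> u \<longrightarrow>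
     set_integrable lborel {v..u} f \<and> (LINT w:{v..u}|lborel. f w) = F u - F v)"

lemma increments_onD:
  assumes "increments_on I F f" "v \<in> I" "u \<in> I" "v \<le> u"
  shows "set_integrable lborel {v..u} f" "(LINT w:{v..u}|lborel. f w) = F u - F v"
  using assms by (auto simp: increments_on_def)

lemma increments_on_diff:
  assumes "increments_on I F f" "increments_on I G g"
  shows "increments_on I (\<lambda>x. F x - G x) (\<lambda>x. f x - g x)"
  using assms by (auto simp: increments_on_def set_integral_diff)

lemma increments_on_DERIV:
  assumes "\<And>x. DERIV F x :> f x" "\<And>x. isCont f x"
  shows "increments_on I F f"
proof -
  have "set_integrable lborel {v..u} f \<and> (LINT w:{v..u}|lborel. f w) = F u - F v"
    if "v \<le> u" for u v
    using has_bochner_integral_FTC_Icc_real[OF that, of F f] assms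
    by (simp add: set_integrable_def set_lebesgue_integral_def has_bochner_integral_iff mult.commute)
  then show ?thesis by (simp add: increments_on_def)
qed

lemma increments_on_nonneg:
  assumes inc: "increments_on I F f" and "u \<in> I" "v \<in> I" "v \<le> u"
    and nn: "\<And>w. w \<in> {v..u} \<Longrightarrow> 0 \<le> f w"
  shows "F v \<le> F u"
proof -
  have "0 \<le> (LINT w:{v..u}|lborel. f w)"
    unfolding set_lebesgue_integral_def using nn
    by (intro integral_nonneg_AE AE_I2) (auto simp: indicator_def)
  with increments_onD(2)[OF inc assms(3,2,4)] show ?thesis by simp
qed

lemma set_integral_mixture:
  fixes H :: "real \<Rightarrow> real \<Rightarrow> real"
  assumes H [measurable]: "case_prod H \<in> borel_measurable (borel \<Otimes>\<^sub>M borel)"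
    and int: "\<And>w. w \<in> {v..u} \<Longrightarrow> integrable lborel (\<lambda>l. H l w)"
    and eq: "\<And>w. w \<in> {v..u} \<Longrightarrow> (LINT l|lborel. H l w) = d w"
    and \<sigma>: "\<bar>\<sigma>\<bar> = 1" and sgn: "\<And>w l. w \<in> {v..u} \<Longrightarrow> 0 \<le> \<sigma> * H l w"
    and d: "set_integrable lborel {v..u} d"
  shows "integrable lborel (\<lambda>l. (LINT w:{v..u}|lborel. H l w))"
    and "(LINT l|lborel. (LINT w:{v..u}|lborel. H l w)) = (LINT w:{v..u}|lborel. d w)"
proof -
  define f where "f = (\<lambda>(l, w). indicator {v..u} w * H l w)"
  have f: "f \<in> borel_measurable (lborel \<Otimes>\<^sub>M lborel)" unfolding f_def by measurable
  have f': "(\<lambda>(w, l). f (l, w)) \<in> borel_measurable (lborel \<Otimes>\<^sub>M lborel)" unfolding f_def by measurable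
  \<comment> \<open>The constant sign gives \<open>\<bar>H l w\<bar> = \<sigma> * H l w\<close>, so
    the inner integral is \<open>\<sigma> * d w = \<bar>d w\<bar>\<close>. Integrability of
    \<open>d\<close> is thus the absolute integrability that Fubini requires.\<close>
  have n: "(LINT l|lborel. norm (f (l, w))) = norm (indicator {v..u} w * d w)" for w
  proof (cases "w \<in> {v..u}")
    case True
    have "\<bar>H l w\<bar> = \<sigma> * H l w" for l
      using sgn[OF True, of l] \<sigma> abs_mult[of \<sigma> "H l w"] by simp
    then have "(LINT l|lborel. norm (f (l, w))) = \<sigma> * d w" using True by (simp add: f_def eq)
    moreover have "0 \<le> \<sigma> * d w"
      using integral_nonneg_AE[of "\<lambda>l. \<sigma> * H l w" lborel] sgn[OF True] by (simp add: eq[OF True])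
    ultimately show ?thesis
      using True \<sigma> abs_mult[of \<sigma> "d w"] by simp
  qed (simp add: f_def)
  have "integrable (lborel \<Otimes>\<^sub>M lborel) (\<lambda>(w, l). f (l, w))"
  proof (rule lborel_pair.Fubini_integrable[OF f'])
    show "integrable lborel (\<lambda>w. LINT l|lborel. norm (case (w, l) of (w, l) \<Rightarrow> f (l, w)))"
      unfolding prod.case n using d by (intro integrable_norm) (simp add: set_integrable_def)
    have "integrable lborel (\<lambda>l. f (l, w))" for w
      using int[of w] by (cases "w \<in> {v..u}") (simp_all add: f_def)
    then show "AE w in lborel. integrable lborel (\<lambda>l. case (w, l) of (w, l) \<Rightarrow> f (l, w))" by simp
  qed
  then have f_int: "integrable (lborel \<Otimes>\<^sub>M lborel) f"
    using lborel_pair.integrable_product_swap_iff[of f] by simp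
  show "integrable lborel (\<lambda>l. (LINT w:{v..u}|lborel. H l w))"
    using lborel_pair.integrable_fst'[OF f_int] by (simp add: f_def set_lebesgue_integral_def)
  have "(LINT l|lborel. (LINT w|lborel. f (l, w))) = (LINT w|lborel. (LINT l|lborel. f (l, w)))"
    using lborel_pair.Fubini_integral[of "\<lambda>l w. f (l, w)"] f_int by simp
  also have "\<dots> = (LINT w:{v..u}|lborel. d w)"
    unfolding set_lebesgue_integral_def
    by (intro Bochner_Integration.integral_cong) (auto simp: f_def eq indicator_def)
  finally show "(LINT l|lborel. (LINT w:{v..u}|lborel. H l w)) = (LINT w:{v..u}|lborel. d w)"
    by (simp add: f_def set_lebesgue_integral_def)
qed

text \<open>
  The sign of \<open>H l u\<close> depends only on \<open>u\<close>. So \<open>\<integral> \<bar>H l u\<bar> dl = \<bar>d u\<bar>\<close>, which is what makes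
  Fubini applicable, and integrating from \<open>s\<close> gives the same pattern with \<open>m\<close> raised by one.
\<close>

definition mixture_on ::
    "real set \<Rightarrow> real \<Rightarrow> nat \<Rightarrow> (real \<Rightarrow> real \<Rightarrow> real) \<Rightarrow> (real \<Rightarrow> real) \<Rightarrow> bool" where
  "mixture_on I s m H d \<longleftrightarrow>
     case_prod H \<in> borel_measurable (borel \<Otimes>\<^sub>M borel) \<and>
     (\<forall>u\<in>I. integrable lborel (\<lambda>l. H l u) \<and> (LINT l|lborel. H l u) = d u \<and>
        (\<forall>l. (s \<le> u \<longrightarrow> 0 \<le> H l u) \<and> (u \<le> s \<longrightarrow> 0 \<le> (-1) ^ m * H l u)))"

lemma mixture_on_integrate:
  assumes I: "\<And>x y. x \<in> I \<Longrightarrow> y \<le> x \<Longrightarrow> y \<in> I" and s: "s \<in> I"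
    and mix: "mixture_on I s m H d'"
    and d: "increments_on I d d'" and h: "\<And>l. increments_on I (h l) (H l)"
    and hm [measurable]: "case_prod h \<in> borel_measurable (borel \<Otimes>\<^sub>M borel)"
  shows "mixture_on I s (Suc m) (\<lambda>l u. h l u - h l s) (\<lambda>u. d u - d s)"
  unfolding mixture_on_def
proof (intro conjI ballI allI impI)
  show "(\<lambda>(l, u). h l u - h l s) \<in> borel_measurable (borel \<Otimes>\<^sub>M borel)" by measurable
next
  have Hm: "case_prod H \<in> borel_measurable (borel \<Otimes>\<^sub>M borel)" using mix by (simp add: mixture_on_def)
  fix u assume u: "u \<in> I"
  have sg: "0 \<le> h l u - h l s" if "s \<le> u" for l
    using increments_on_nonneg[OF h u s that] mix that I[OF u] by (auto simp: mixture_on_def)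
  \<comment> \<open>Left of \<open>s\<close> the integral over \<open>{u..s}\<close> yields
    \<open>h l s - h l u\<close>; reversing this difference produces the extra factor -1.\<close>
  have sg': "0 \<le> (- 1) ^ Suc m * (h l u - h l s)" if "u \<le> s" for l
  proof -
    have "0 \<le> (LINT w:{u..s}|lborel. (-1) ^ m * H l w)"
      unfolding set_lebesgue_integral_def using mix I[OF s]
      by (intro integral_nonneg_AE AE_I2) (auto simp: indicator_def mixture_on_def)
    also have "\<dots> = (- 1) ^ m * (h l s - h l u)"
      by (simp add: increments_onD(2)[OF h u s that])
    finally show ?thesis by (simp add: algebra_simps)
  qed
  show "0 \<le> h l u - h l s" if "s \<le> u" for l by (rule sg[OF that])
  show "0 \<le> (- 1) ^ Suc m * (h l u - h l s)" if "u \<le> s" for l by (rule sg'[OF that])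
  have "integrable lborel (\<lambda>l. h l u - h l s) \<and> (LINT l|lborel. h l u - h l s) = d u - d s"
  proof (cases "s \<le> u")
    case True
    have "integrable lborel (\<lambda>l. (LINT w:{s..u}|lborel. H l w))"
      "(LINT l|lborel. (LINT w:{s..u}|lborel. H l w)) = (LINT w:{s..u}|lborel. d' w)"
      by (rule set_integral_mixture[where \<sigma> = 1, OF Hm];
          use mix I[OF u] increments_onD(1)[OF d s u True] in \<open>auto simp: mixture_on_def\<close>)+
    then show ?thesis
      by (simp add: increments_onD(2)[OF h s u True] increments_onD(2)[OF d s u True])
  next
    case False
    then have le: "u \<le> s" by simp
    have "integrable lborel (\<lambda>l. (LINT w:{u..s}|lborel. H l w))"
      "(LINT l|lborel. (LINT w:{u..s}|lborel. H l w)) = (LINT w:{u..s}|lborel. d' w)"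
      by (rule set_integral_mixture[where \<sigma> = "(-1) ^ m", OF Hm];
          use mix I[OF s] increments_onD(1)[OF d u s le] in \<open>auto simp: mixture_on_def\<close>)+
    then have "integrable lborel (\<lambda>l. - (h l s - h l u))" "(LINT l|lborel. - (h l s - h l u)) = - (d s - d u)"
      by (simp_all only: increments_onD(2)[OF h u s le] increments_onD(2)[OF d u s le]
            integrable_minus integral_minus)
    then show ?thesis by (simp only: minus_diff_eq)
  qed
  then show "integrable lborel (\<lambda>l. h l u - h l s)" "(LINT l|lborel. h l u - h l s) = d u - d s"
    by auto
qed

lemma DERIV_max_power:
  fixes x :: real
  shows "DERIV (\<lambda>x. (max 0 (x - t)) ^ Suc (Suc m) / fact (Suc (Suc m))) x :> (max 0 (x - t)) ^ Suc m / fact (Suc m)"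
proof -
  have *: "DERIV (\<lambda>y. (max 0 y) ^ Suc (Suc m)) y :> real (Suc (Suc m)) * (max 0 y) ^ Suc m" for y :: real
  proof -
    consider "y < 0" | "y = 0" | "0 < y" by linarith
    then show ?thesis
    proof cases
      case 1
      have "DERIV (\<lambda>y. (max 0 y) ^ Suc (Suc m)) y :> 0"
        by (rule has_field_derivative_transform_within_open[where S = "{..<0}" and f = "\<lambda>_. 0"])
           (use 1 in auto)
      then show ?thesis using 1 by simp
    next
      case 2
      \<comment> \<open>At the kink, Caratheodory's criterion applies: the quotient factor
        \<open>(max 0 z) ^ Suc m\<close> is continuous and vanishes at 0.\<close>
      have "(max 0 z) ^ Suc (Suc m) = (max 0 z) ^ Suc m * z" for z :: real by (auto simp: max_def)
      then show ?thesis
        unfolding CARAT_DERIV using 2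
        by (intro exI[of _ "\<lambda>z. (max 0 z) ^ Suc m"]) (auto intro!: continuous_intros)
    next
      case 3
      have "DERIV (\<lambda>y. y ^ Suc (Suc m)) y :> real (Suc (Suc m)) * y ^ Suc m"
        by (rule DERIV_cong, rule DERIV_pow) simp
      then have "DERIV (\<lambda>y. (max 0 y) ^ Suc (Suc m)) y :> real (Suc (Suc m)) * y ^ Suc m"
        by (rule has_field_derivative_transform_within_open[where S = "{0<..}"])
           (use 3 in auto)
      then show ?thesis using 3 by simp
    qed
  qed
  have "DERIV (\<lambda>x. x - t) x :> 1" by (auto intro!: derivative_eq_intros)
  from DERIV_chain2[OF * this]
  have "DERIV (\<lambda>x. (max 0 (x - t)) ^ Suc (Suc m)) x :> real (Suc (Suc m)) * (max 0 (x - t)) ^ Suc m"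
    by (simp del: power_Suc)
  from DERIV_cdivide[OF this, of "fact (Suc (Suc m))"] show ?thesis
    by (rule DERIV_cong) (subst fact_Suc[of "Suc m"], simp del: power_Suc fact_Suc)
qed

subsection \<open>Truncated powers at the level points of a monotone function\<close>

locale level_kernel =
  fixes I :: "real set" and g :: "real \<Rightarrow> real"
  assumes nonempty: "I \<noteq> {}" and down_closed: "x \<in> I \<Longrightarrow> y \<le> x \<Longrightarrow> y \<in> I"
    and mono_g: "mono_on I g"
begin

text \<open>The second condition bounds the superlevel set from below, so that its infimum is a real
  point. Levels below all values of \<open>g\<close> would contribute only constants; those above
  all values contribute nothing.\<close>

definition levels :: "real set" where
  "levels = {l. (\<exists>x\<in>I. l \<le> g x) \<and> (\<exists>x\<in>I. g x < l)}"

text \<open>The generalized inverse (quantile function) of \<open>g\<close>.\<close>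

definition jump :: "real \<Rightarrow> real" where
  "jump l = Inf {x\<in>I. l \<le> g x}"

text \<open>
  For \<open>m = 0\<close> the kernel is the indicator of the superlevel set itself, which may differ from
  \<open>trunc_power 0 (jump l)\<close> at \<open>jump l\<close>; this avoids any appeal to one-sided continuity of \<open>g\<close>.
\<close>

definition ker :: "nat \<Rightarrow> real \<Rightarrow> real \<Rightarrow> real" where
  "ker m l u = (if l \<notin> levels then 0
     else if m = 0 then of_bool (u \<in> I \<and> l \<le> g u) else (max 0 (u - jump l)) ^ m / fact m)"

lemma I_borel [measurable]: "I \<in> sets borel"
  by (rule real_interval_borel_measurable) (auto simp: is_interval_1 intro: down_closed)

lemma levelsE:
  assumes "l \<in> levels"
  obtains x y where "x \<in> I" "g x < l" "y \<in> I" "l \<le> g y" "\<And>z. z \<in> I \<Longrightarrow> l \<le> g z \<Longrightarrow> x < z"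
proof -
  obtain x y where xy: "x \<in> I" "g x < l" "y \<in> I" "l \<le> g y"
    using assms by (auto simp: levels_def)
  have "x < z" if "z \<in> I" "l \<le> g z" for z
    using mono_onD[OF mono_g that(1) xy(1)] xy(2) that(2) by (cases "z \<le> x") auto
  with xy show ?thesis using that by blast
qed

lemma bdd_below_level: "l \<in> levels \<Longrightarrow> bdd_below {x\<in>I. l \<le> g x}"
  by (erule levelsE) (auto simp: bdd_below_def intro: less_imp_le)

lemma jump_le: "l \<in> levels \<Longrightarrow> u \<in> I \<Longrightarrow> l \<le> g u \<Longrightarrow> jump l \<le> u"
  unfolding jump_def by (rule cInf_lower) (auto intro: bdd_below_level)

lemma level_le_if_jump_less:
  assumes "l \<in> levels" "u \<in> I" "jump l < u"
  shows "l \<le> g u"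
proof -
  have "{x\<in>I. l \<le> g x} \<noteq> {}" using assms(1) by (auto simp: levels_def)
  then obtain y where "y \<in> I" "l \<le> g y" "y < u"
    using cInf_lessD[of "{x\<in>I. l \<le> g x}" u] assms(3) by (auto simp: jump_def)
  with mono_onD[OF mono_g, of y u] assms(2) show ?thesis by simp
qed

text \<open>Even if the infimum is not in the superlevel set, it lies below a point of
  \<open>I\<close>. Hence condition (iii) is available at \<open>t = jump l\<close>.\<close>

lemma jump_in:
  assumes "l \<in> levels"
  shows "jump l \<in> I"
  using assms by (rule levelsE) (rule down_closed, assumption, rule jump_le[OF assms])

lemma ker_nonneg: "0 \<le> ker m l u"
  by (simp add: ker_def)

text \<open>The set \<open>levels\<close> is an interval, and \<open>jump\<close> and
  \<open>g\<close> are monotone, hence Borel on their domains. Extending both by 0 does not change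
  the kernel, whose conditions exclude the added points.\<close>

lemma measurable_ker [measurable]: "case_prod (ker m) \<in> borel_measurable (borel \<Otimes>\<^sub>M borel)"
proof -
  have "levels \<in> sets borel"
    by (rule real_interval_borel_measurable) (auto simp: is_interval_1 levels_def intro: order_trans less_le_trans)
  note [measurable] = this
  have "mono_on levels jump"
  proof (rule mono_onI)
    fix l l' assume l: "l \<in> levels" "l' \<in> levels" "l \<le> l'"
    show "jump l \<le> jump l'" unfolding jump_def
      by (rule cInf_superset_mono) (use l bdd_below_level in \<open>auto simp: levels_def\<close>)
  qed
  then have "jump \<in> borel_measurable (restrict_space borel levels)" by (rule borel_measurable_mono_on_fnc)
  then have [measurable]: "(\<lambda>l. if l \<in> levels then jump l else 0) \<in> borel_measurable borel" (is "?J \<in> _")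
    by (subst (asm) measurable_restrict_space_iff) auto
  have "g \<in> borel_measurable (restrict_space borel I)" by (rule borel_measurable_mono_on_fnc[OF mono_g])
  then have [measurable]: "(\<lambda>u. if u \<in> I then g u else 0) \<in> borel_measurable borel" (is "?G \<in> _")
    by (subst (asm) measurable_restrict_space_iff) auto
  have "case_prod (ker m) = (\<lambda>(l, u). if l \<notin> levels then 0
     else if m = 0 then of_bool (u \<in> I \<and> l \<le> ?G u) else (max 0 (u - ?J l)) ^ m / fact m)"
    by (auto simp: ker_def fun_eq_iff)
  then show ?thesis
    unfolding of_bool_def by simp
qed

lemma increments_on_ker: "increments_on I (ker (Suc m) l) (ker m l)"
proof (cases "l \<in> levels")
  case False
  then show ?thesis by (simp add: increments_on_def ker_def set_integrable_def)
next
  case l: True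
  show ?thesis
  proof (cases m)
    case (Suc m')
    have "ker m l = (\<lambda>x. (max 0 (x - jump l)) ^ Suc m' / fact (Suc m'))"
      "ker (Suc m) l = (\<lambda>x. (max 0 (x - jump l)) ^ Suc (Suc m') / fact (Suc (Suc m')))"
      using l Suc by (auto simp: ker_def simp del: power_Suc fact_Suc)
    then show ?thesis
      by (simp only:) (rule increments_on_DERIV[OF DERIV_max_power], intro continuous_intros, simp)
  next
    case 0
    have "set_integrable lborel {v..u} (ker 0 l) \<and>
       (LINT w:{v..u}|lborel. ker 0 l w) = max 0 (u - jump l) - max 0 (v - jump l)"
      if vu: "v \<in> I" "u \<in> I" "v \<le> u" for v u
    proof -
      \<comment> \<open>At \<open>jump l\<close> the superlevel set may be open or closed, and the
        half-open interval below may omit the left end \<open>v\<close>; both points are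
        null.\<close>
      have "AE w in lborel. w \<noteq> jump l" "AE w in lborel. w \<noteq> v" by (rule AE_lborel_singleton)+
      then have ae: "AE w in lborel. indicator {v..u} w *\<^sub>R ker 0 l w = (indicator {max v (jump l)<..u} w :: real)"
      proof eventually_elim
        case (elim w)
        show ?case
        proof (cases "w \<in> {v..u}")
          case True
          then have w: "w \<in> I" using down_closed vu by auto
          have "l \<le> g w \<longleftrightarrow> jump l < w"
            using jump_le[OF l w] level_le_if_jump_less[OF l w] elim by (auto simp: less_le)
          then show ?thesis using True elim w l by (auto simp: ker_def indicator_def)
        qed (auto simp: indicator_def)
      qed
      have m: "(\<lambda>w. indicator {v..u} w *\<^sub>R ker 0 l w) \<in> borel_measurable lborel" by measurable
      have "integrable lborel (\<lambda>w. indicator {max v (jump l)<..u} w :: real)"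
        by (cases "max v (jump l) \<le> u") auto
      then have "integrable lborel (\<lambda>w. indicator {v..u} w *\<^sub>R ker 0 l w)"
        using integrable_cong_AE[OF m _ ae] by simp
      moreover have "(LINT w|lborel. indicator {v..u} w *\<^sub>R ker 0 l w) = measure lborel {max v (jump l)<..u}"
        using integral_cong_AE[OF m _ ae] by simp
      moreover have "measure lborel {max v (jump l)<..u} = max 0 (u - jump l) - max 0 (v - jump l)"
        using vu by (cases "jump l \<le> v"; cases "jump l \<le> u") auto
      ultimately show ?thesis by (simp add: set_integrable_def set_lebesgue_integral_def)
    qed
    then show ?thesis using l 0 by (simp add: increments_on_def ker_def)
  qed
qed

lemma ker_mono: "u \<in> I \<Longrightarrow> v \<le> u \<Longrightarrow> ker m l v \<le> ker m l u"
  using mono_onD[OF mono_g, of v u] down_closed[of u v]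
  by (auto simp: ker_def intro!: divide_right_mono power_mono)

lemma ker_0_diff:
  assumes "v \<in> I" "u \<in> I" "v \<le> u"
  shows "ker 0 l u - ker 0 l v = indicator {g v<..g u} l"
  using mono_onD[OF mono_g assms] assms by (auto simp: ker_def levels_def indicator_def not_le)

text \<open>The difference of the kernels is, up to sign, the indicator of the levels between
  \<open>g s\<close> and \<open>g u\<close>. Without subtracting the value at \<open>s\<close> the
  integral over \<open>l\<close> could diverge, as \<open>g\<close> may be unbounded below.\<close>

lemma mixture_on_ker_0_diff:
  assumes s: "s \<in> I"
  shows "mixture_on I s 1 (\<lambda>l u. ker 0 l u - ker 0 l s) (\<lambda>u. g u - g s)"
proof -
  have *: "integrable lborel (\<lambda>l. ker 0 l u - ker 0 l v)" "(LINT l|lborel. ker 0 l u - ker 0 l v) = g u - g v"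
    if "v \<in> I" "u \<in> I" "v \<le> u" for u v
    using mono_onD[OF mono_g that] by (simp_all add: ker_0_diff[OF that])
  have **: "integrable lborel (\<lambda>l. ker 0 l u - ker 0 l s) \<and> (LINT l|lborel. ker 0 l u - ker 0 l s) = g u - g s"
    if u: "u \<in> I" for u
  proof (cases "s \<le> u")
    case False
    then have "integrable lborel (\<lambda>l. - (ker 0 l s - ker 0 l u))"
      "(LINT l|lborel. - (ker 0 l s - ker 0 l u)) = - (g s - g u)"
      using *[OF u s] by (simp_all only: integrable_minus integral_minus)
    then show ?thesis by (simp only: minus_diff_eq)
  qed (use * s u in auto)
  have "(\<lambda>(l, u). ker 0 l u - ker 0 l s) \<in> borel_measurable (borel \<Otimes>\<^sub>M borel)" by measurable
  then show ?thesis
    using ** ker_mono s unfolding mixture_on_def by (auto simp: ker_mono)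
qed

lemma mixture_on_ker_0:
  assumes nn: "\<And>u. u \<in> I \<Longrightarrow> 0 \<le> g u"
  shows "mixture_on I s 0 (ker 0) (\<lambda>u. g u - Inf (g ` I))"
proof -
  have bdd: "bdd_below (g ` I)" using nn by (auto simp: bdd_below_def)
  have "ker 0 l u = indicator {Inf (g ` I)<..g u} l" if u: "u \<in> I" for l u
    using cInf_less_iff[OF _ bdd, of l] nonempty u by (auto simp: ker_def levels_def indicator_def)
  moreover have "Inf (g ` I) \<le> g u" if u: "u \<in> I" for u by (rule cInf_lower) (use bdd u in auto)
  moreover have "case_prod (ker 0) \<in> borel_measurable (borel \<Otimes>\<^sub>M borel)" by measurable
  ultimately show ?thesis using ker_nonneg unfolding mixture_on_def by simp
qed

text \<open>
  A nonnegative \<open>d\<close> on an interval unbounded below cannot have a derivative bounded below by a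
  positive constant; hence \<open>C = 0\<close>.
\<close>

lemma mixture_on_ker_Suc:
  assumes mix: "mixture_on I s 0 (ker m) (\<lambda>u. d' u - C)" and C: "0 \<le> C"
    and inc: "increments_on I d d'" and nn: "\<And>u. u \<in> I \<Longrightarrow> 0 \<le> d u"
  shows "mixture_on I s 0 (ker (Suc m)) (\<lambda>u. d u - Inf (d ` I))"
proof -
  have lin: "increments_on I (\<lambda>u. C * u) (\<lambda>u. C)"
    by (rule increments_on_DERIV) (auto intro!: derivative_eq_intros)
  have step: "mixture_on I v 1 (\<lambda>l u. ker (Suc m) l u - ker (Suc m) l v)
       (\<lambda>u. (d u - C * u) - (d v - C * v))" if v: "v \<in> I" for v
    unfolding One_nat_def
  proof (rule mixture_on_integrate[OF down_closed v _ increments_on_diff[OF inc lin] increments_on_ker])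
    show "mixture_on I v 0 (ker m) (\<lambda>u. d' u - C)" using mix ker_nonneg by (auto simp: mixture_on_def)
  qed (auto intro: measurable_ker)
  have ge: "d v + C * (u - v) \<le> d u" if "u \<in> I" "v \<in> I" "v \<le> u" for u v
  proof -
    have "0 \<le> (LINT l|lborel. ker (Suc m) l u - ker (Suc m) l v)"
      using ker_mono[OF that(1,3)] by (intro integral_nonneg_AE AE_I2) simp
    also have "\<dots> = (d u - C * u) - (d v - C * v)"
      using step[OF that(2)] that by (simp add: mixture_on_def)
    finally show ?thesis by (simp add: algebra_simps)
  qed
  have C0: "C = 0"
  proof (rule ccontr)
    assume "C \<noteq> 0"
    with C have C': "C > 0" by simp
    obtain u where u: "u \<in> I" using nonempty by blast
    \<comment> \<open>Chosen so that \<open>C * (u - v) = d u + C\<close>, which exceeds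
      \<open>d u\<close> and contradicts \<open>ge\<close>, as \<open>d v\<close> is
      nonnegative.\<close>
    define v where "v = u - (d u / C + 1)"
    have "v \<le> u" using divide_nonneg_pos[OF nn[OF u] C'] by (simp add: v_def)
    then have "v \<in> I" "C * (u - v) \<le> d u"
      using ge[of u v] down_closed[OF u] nn[of v] u by auto
    then show False using C' mult_pos_pos[OF C' C'] by (simp add: v_def field_simps)
  qed
  have bdd: "bdd_below (d ` I)" using nn by (auto simp: bdd_below_def)
  have "integrable lborel (\<lambda>l. ker (Suc m) l u) \<and> (LINT l|lborel. ker (Suc m) l u) = d u - Inf (d ` I)"
    if u: "u \<in> I" for u
  proof -
    have ui: "u - real i \<in> I" for i using u by (rule down_closed) simp
    \<comment> \<open>The lower limit \<open>u - i\<close> is sent to -\<infinity>. The kernel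
      vanishes left of \<open>jump l\<close>, so \<open>f i l\<close> increases to
      \<open>ker (Suc m) l u\<close>, while \<open>d (u - i)\<close> decreases to the infimum of
      \<open>d\<close>; monotone convergence concludes.\<close>
    define f where "f = (\<lambda>i l. ker (Suc m) l u - ker (Suc m) l (u - real i))"
    have fi: "integrable lborel (f i)" "integral\<^sup>L lborel (f i) = d u - d (u - real i)" for i
      using step[OF ui, of i] u C0 by (auto simp: mixture_on_def f_def)
    have mono: "AE l in lborel. mono (\<lambda>i. f i l)"
      using ui by (intro AE_I2 monoI) (auto simp: f_def intro!: diff_left_mono ker_mono)
    have lim: "AE l in lborel. (\<lambda>i. f i l) \<longlonglongrightarrow> ker (Suc m) l u"
    proof (intro AE_I2 tendsto_eventually)
      fix l
      have "\<forall>\<^sub>F i in sequentially. u - jump l \<le> real i"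
        using filterlim_real_sequentially by (simp add: filterlim_at_top)
      then show "\<forall>\<^sub>F i in sequentially. f i l = ker (Suc m) l u"
        by eventually_elim (auto simp: f_def ker_def)
    qed
    have "(\<lambda>i. d (u - real i)) \<longlonglongrightarrow> Inf (d ` I)"
    proof (rule decreasing_tendsto)
      show "\<forall>\<^sub>F i in sequentially. Inf (d ` I) \<le> d (u - real i)"
        by (rule always_eventually) (auto intro!: cInf_lower bdd ui)
      fix x assume "Inf (d ` I) < x"
      then obtain y where y: "y \<in> I" "d y < x" using cInf_lessD[of "d ` I" x] nonempty by auto
      have "\<forall>\<^sub>F i in sequentially. u - y \<le> real i"
        using filterlim_real_sequentially by (simp add: filterlim_at_top)
      then show "\<forall>\<^sub>F i in sequentially. d (u - real i) < x"
      proof eventually_elim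
        case (elim i)
        with ge[OF y(1) ui[of i]] y(2) C0 show ?case by simp
      qed
    qed
    then have "(\<lambda>i. integral\<^sup>L lborel (f i)) \<longlonglongrightarrow> d u - Inf (d ` I)"
      unfolding fi by (intro tendsto_diff tendsto_const)
    then have "has_bochner_integral lborel (\<lambda>l. ker (Suc m) l u) (d u - Inf (d ` I))"
      by (intro has_bochner_integral_monotone_convergence[OF fi(1) mono lim]) measurable
    then show ?thesis by (simp add: has_bochner_integral_iff)
  qed
  moreover have "case_prod (ker (Suc m)) \<in> borel_measurable (borel \<Otimes>\<^sub>M borel)" by measurable
  ultimately show ?thesis using ker_nonneg unfolding mixture_on_def by simp
qed

text \<open>\<open>E i\<close> is an \<open>i\<close>-fold antiderivative of \<open>g\<close>; for a
  function with derivatives \<open>D\<close> it will be \<open>D (n - i)\<close>. The infimum of one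
  stage is the constant \<open>C\<close> that the next stage shows to be 0.\<close>

lemma mixture_on_ker_iterated:
  assumes "\<And>i. i < p \<Longrightarrow> increments_on I (E (Suc i)) (E i)" "E 0 = g"
    and "\<And>i u. i \<le> p \<Longrightarrow> u \<in> I \<Longrightarrow> 0 \<le> E i u"
  shows "\<exists>C\<ge>0. mixture_on I s 0 (ker p) (\<lambda>u. E p u - C)"
proof -
  have "mixture_on I s 0 (ker p) (\<lambda>u. E p u - Inf (E p ` I))"
    using assms
  proof (induction p)
    case 0
    then show ?case using mixture_on_ker_0[of s] by simp
  next
    case (Suc p)
    have "0 \<le> Inf (E p ` I)" using nonempty Suc.prems(3)[of p] by (intro cInf_greatest) auto
    with Suc show ?case by (intro mixture_on_ker_Suc[of s p "E p"]) auto
  qed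
  moreover have "0 \<le> Inf (E p ` I)" using nonempty assms(3)[of p] by (intro cInf_greatest) auto
  ultimately show ?thesis by blast
qed

lemma increments_on_sum_power:
  "increments_on I (\<lambda>u. \<Sum>r\<le>j. c r / real (Suc r) * (u - s) ^ Suc r) (\<lambda>u. \<Sum>r\<le>j. c r * (u - s) ^ r)"
proof (rule increments_on_DERIV)
  fix x
  have "DERIV (\<lambda>u. c r / real (Suc r) * (u - s) ^ Suc r) x :> c r * (x - s) ^ r" for r
  proof -
    have "DERIV (\<lambda>u. (u - s) ^ Suc r) x :> real (Suc r) * (x - s) ^ r"
      by (rule derivative_eq_intros refl)+ simp
    from DERIV_cmult[OF this, of "c r / real (Suc r)"] show ?thesis by simp
  qed
  then show "DERIV (\<lambda>u. \<Sum>r\<le>j. c r / real (Suc r) * (u - s) ^ Suc r) x :> (\<Sum>r\<le>j. c r * (x - s) ^ r)"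
    by (intro DERIV_sum) auto
qed (intro continuous_intros)

text \<open>Integrating \<open>j\<close> times from \<open>s\<close> subtracts from the kernel and
  from \<open>D (p - j)\<close> their Taylor polynomials at \<open>s\<close>: here
  \<open>a r l\<close> is \<open>ker (M + j - r) l s / fact r\<close> and \<open>b r\<close> is
  \<open>D (p - j + r) s / fact r\<close>. The linear term \<open>C * (u - s)\<close> grows into the
  term of degree \<open>Suc j\<close>.\<close>

lemma mixture_on_taylor:
  assumes D: "\<And>j. j < p \<Longrightarrow> increments_on I (D j) (D (Suc j))" and s: "s \<in> I"
    and base: "mixture_on I s 1 (\<lambda>l u. ker M l u - ker M l s) (\<lambda>u. D p u - D p s - C * (u - s))"
    and "j \<le> p"
  shows "\<exists>a b. (\<forall>r. a r \<in> borel_measurable borel) \<and>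
     mixture_on I s (Suc j) (\<lambda>l u. ker (M + j) l u - (\<Sum>r\<le>j. a r l * (u - s) ^ r))
       (\<lambda>u. D (p - j) u - ((\<Sum>r\<le>j. b r * (u - s) ^ r) + C / fact (Suc j) * (u - s) ^ Suc j))"
  using \<open>j \<le> p\<close>
proof (induction j)
  case 0
  have "(\<lambda>l. ker M l s) \<in> borel_measurable borel" by measurable
  then show ?case using base
    by (intro exI[of _ "\<lambda>_ l. ker M l s"] exI[of _ "\<lambda>_. D p s"]) (simp add: diff_diff_eq)
next
  case (Suc j)
  then obtain a b where a [measurable]: "\<And>r. a r \<in> borel_measurable borel" and
    mix: "mixture_on I s (Suc j) (\<lambda>l u. ker (M + j) l u - (\<Sum>r\<le>j. a r l * (u - s) ^ r))
       (\<lambda>u. D (p - j) u - ((\<Sum>r\<le>j. b r * (u - s) ^ r) + C / fact (Suc j) * (u - s) ^ Suc j))"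
    by auto
  \<comment> \<open>The \<open>C\<close> term is absorbed as top coefficient, so that one
    antiderivative formula serves the whole polynomial.\<close>
  define c where "c = (\<lambda>r. if r = Suc j then C / fact (Suc j) else b r)"
  have c: "(\<Sum>r\<le>j. b r * (u - s) ^ r) + C / fact (Suc j) * (u - s) ^ Suc j = (\<Sum>r\<le>Suc j. c r * (u - s) ^ r)" for u
    by (simp add: c_def)
  \<comment> \<open>Integration shifts the coefficients by one degree; the new constant term is the
    value at \<open>s\<close>.\<close>
  define a' where "a' = (\<lambda>r. case r of 0 \<Rightarrow> (\<lambda>l. ker (M + Suc j) l s) | Suc r \<Rightarrow> (\<lambda>l. a r l / real (Suc r)))"
  define b' where "b' = (\<lambda>r. case r of 0 \<Rightarrow> D (p - Suc j) s | Suc r \<Rightarrow> b r / real (Suc r))"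
  have pj: "p - j = Suc (p - Suc j)" using Suc.prems by simp
  have incD: "increments_on I (D (p - Suc j)) (D (p - j))"
    unfolding pj by (rule D) (use Suc.prems in simp)
  have "mixture_on I s (Suc (Suc j))
      (\<lambda>l u. (ker (Suc (M + j)) l u - (\<Sum>r\<le>j. a r l / real (Suc r) * (u - s) ^ Suc r)) -
             (ker (Suc (M + j)) l s - (\<Sum>r\<le>j. a r l / real (Suc r) * (s - s) ^ Suc r)))
      (\<lambda>u. (D (p - Suc j) u - (\<Sum>r\<le>Suc j. c r / real (Suc r) * (u - s) ^ Suc r)) -
           (D (p - Suc j) s - (\<Sum>r\<le>Suc j. c r / real (Suc r) * (s - s) ^ Suc r)))"
    by (rule mixture_on_integrate[OF down_closed s mix[unfolded c]
         increments_on_diff[OF incD increments_on_sum_power]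
         increments_on_diff[OF increments_on_ker increments_on_sum_power]]) (assumption, measurable)
  also have "(\<lambda>l u. (ker (Suc (M + j)) l u - (\<Sum>r\<le>j. a r l / real (Suc r) * (u - s) ^ Suc r)) -
             (ker (Suc (M + j)) l s - (\<Sum>r\<le>j. a r l / real (Suc r) * (s - s) ^ Suc r)))
      = (\<lambda>l u. ker (M + Suc j) l u - (\<Sum>r\<le>Suc j. a' r l * (u - s) ^ r))"
    by (subst sum.atMost_Suc_shift) (simp add: a'_def fun_eq_iff)
  also have "(\<lambda>u. (D (p - Suc j) u - (\<Sum>r\<le>Suc j. c r / real (Suc r) * (u - s) ^ Suc r)) -
           (D (p - Suc j) s - (\<Sum>r\<le>Suc j. c r / real (Suc r) * (s - s) ^ Suc r)))
      = (\<lambda>u. D (p - Suc j) u - ((\<Sum>r\<le>Suc j. b' r * (u - s) ^ r) + C / fact (Suc (Suc j)) * (u - s) ^ Suc (Suc j)))"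
  proof -
    have 1: "(\<Sum>r\<le>Suc j. c r / real (Suc r) * (u - s) ^ Suc r)
        = (\<Sum>r\<le>j. b r / real (Suc r) * (u - s) ^ Suc r) + C / fact (Suc (Suc j)) * (u - s) ^ Suc (Suc j)" for u
      by (simp add: c_def fact_Suc[of "Suc j"] mult.commute del: power_Suc fact_Suc)
    have 2: "(\<Sum>r\<le>Suc j. b' r * (u - s) ^ r)
        = D (p - Suc j) s + (\<Sum>r\<le>j. b r / real (Suc r) * (u - s) ^ Suc r)" for u
      by (subst sum.atMost_Suc_shift) (simp add: b'_def)
    show ?thesis unfolding 1 2 by (simp add: fun_eq_iff)
  qed
  finally have "mixture_on I s (Suc (Suc j))
      (\<lambda>l u. ker (M + Suc j) l u - (\<Sum>r\<le>Suc j. a' r l * (u - s) ^ r))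
      (\<lambda>u. D (p - Suc j) u - ((\<Sum>r\<le>Suc j. b' r * (u - s) ^ r) + C / fact (Suc (Suc j)) * (u - s) ^ Suc (Suc j)))" .
  moreover have "a' r \<in> borel_measurable borel" for r
    by (cases r) (simp_all add: a'_def)
  ultimately show ?case by blast
qed

end

subsection \<open>The classes of polynomials and of generalized monotone functions\<close>

lemma is_derivs_poly:
  "is_derivs I n (restrict (poly p) I) (\<lambda>j. poly ((pderiv ^^ j) p))"
proof -
  have D: "DERIV (poly ((pderiv ^^ j) p)) x :> poly ((pderiv ^^ Suc j) p) x" for j x
    by simp
  have "is_indef_integral I (poly ((pderiv ^^ j) p)) (poly ((pderiv ^^ Suc j) p))" for j
    unfolding is_indef_integral_def
  proof (intro ballI conjI)
    fix x y :: real
    show "interval_lebesgue_integrable lborel (ereal y) (ereal x) (poly ((pderiv ^^ Suc j) p))"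
      by (rule interval_integrable_isCont) simp
    have "(LBINT u=ereal y..ereal x. poly ((pderiv ^^ Suc j) p) u)
        = poly ((pderiv ^^ j) p) x - poly ((pderiv ^^ j) p) y"
      by (rule interval_integral_FTC_finite)
        (auto intro!: continuous_intros D[THEN has_field_derivative_at_within]
           simp flip: has_real_derivative_iff_has_vector_derivative simp del: funpow.simps)
    then show "poly ((pderiv ^^ j) p) x
        = poly ((pderiv ^^ j) p) y + (LBINT u=ereal y..ereal x. poly ((pderiv ^^ Suc j) p) u)" by simp
  qed
  from this[of "n - 1"] have "n \<noteq> 0 \<Longrightarrow> is_indef_integral I (poly ((pderiv ^^ (n - 1)) p)) (poly ((pderiv ^^ n) p))"
    by (simp del: funpow.simps)
  moreover have "one_sided_cont I (poly ((pderiv ^^ n) p))"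
    by (auto simp: one_sided_cont_def intro: continuous_within_subset[OF poly_isCont])
  moreover have "restrict (poly p) I \<in> borel_measurable (restrict_space borel I)"
  proof -
    have "poly p \<in> borel_measurable borel"
      by (intro borel_measurable_continuous_onI continuous_intros)
    then have "poly p \<in> borel_measurable (restrict_space borel I)" by (rule measurable_restrict_space1)
    then show ?thesis by (rule measurable_cong[THEN iffD1, rotated]) (simp add: space_restrict_space)
  qed
  ultimately show ?thesis
    unfolding is_derivs_def using D by (auto intro: has_field_derivative_at_within)
qed

text \<open>For \<open>j \<ge> k - 1\<close> the derivative of order \<open>Suc j\<close> is
  constant: \<open>fact k * coeff p k\<close> if \<open>Suc j = k\<close>, and 0 beyond.\<close>

lemma poly_in_P_plus:
  assumes "1 \<le> k" "degree p \<le> n" "degree p \<le> k" "0 \<le> coeff p k"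
  shows "restrict (poly p) I \<in> P_plus I k n"
proof -
  have "mono_on I (poly ((pderiv ^^ j) p))" if j: "k - 1 \<le> j" for j
  proof -
    have nn: "0 \<le> poly ((pderiv ^^ Suc j) p) x" for x
    proof -
      have deg: "degree ((pderiv ^^ i) p) = degree p - i" for i
        by (induction i) (simp_all add: degree_pderiv)
      have "degree ((pderiv ^^ Suc j) p) = 0"
        unfolding deg using j assms by simp
      then have "poly ((pderiv ^^ Suc j) p) x = coeff ((pderiv ^^ Suc j) p) 0"
        by (elim degree_eq_zeroE) (simp del: funpow.simps)
      also have "\<dots> = pochhammer 1 (Suc j) * coeff p (Suc j)"
        using coeff_higher_pderiv[of "Suc j" p 0] by (simp del: funpow.simps)
      also have "0 \<le> \<dots>"
      proof (cases "Suc j = k")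
        case True
        then show ?thesis using assms(4) by (simp add: pochhammer_fact[symmetric] del: pochhammer_Suc)
      next
        case False
        then have "degree p < Suc j" using j assms by simp
        then show ?thesis by (simp add: coeff_eq_0)
      qed
      finally show ?thesis .
    qed
    show ?thesis
    proof (rule mono_onI)
      fix x y :: real assume "x \<le> y"
      then show "poly ((pderiv ^^ j) p) x \<le> poly ((pderiv ^^ j) p) y"
      proof (rule DERIV_nonneg_imp_nondecreasing)
        fix w
        show "\<exists>y'. DERIV (poly ((pderiv ^^ j) p)) w :> y' \<and> 0 \<le> y'"
          by (rule exI, rule conjI[OF poly_DERIV]) (use nn[of w] in simp)
      qed
    qed
  qed
  then have "restrict (poly p) I \<in> F_plus I k n"
    using is_derivs_poly[of I n p] by (auto simp: F_plus_def S_class_def)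
  then show ?thesis using assms(2) by (auto simp: P_plus_def)
qed

section \<open>Representation of generalized monotone functions as mixtures\<close>

lemma set_integrable_Icc_if_interval_integrable:
  fixes v u :: real
  assumes "v \<le> u" "interval_lebesgue_integrable lborel (ereal v) (ereal u) f"
  shows "set_integrable lborel {v..u} f"
proof -
  have pt: "set_integrable lborel {x} f" for x :: real
  proof -
    have "(\<lambda>y. indicator {x} y *\<^sub>R f y) = (\<lambda>y. indicator {x} y *\<^sub>R f x)" by (auto simp: indicator_def)
    then show ?thesis by (simp add: set_integrable_def)
  qed
  have "set_integrable lborel {v<..<u} f"
    using assms by (simp add: interval_lebesgue_integrable_def)
  then have "set_integrable lborel ({v<..<u} \<union> {v} \<union> {u}) f"
    by (intro set_integrable_Un pt) auto
  also have "{v<..<u} \<union> {v} \<union> {u} = {v..u}" using assms(1) by auto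
  finally show ?thesis .
qed

lemma is_derivs_increments_on:
  assumes I: "is_interval I" and D: "is_derivs I n f D" and j: "j < n"
  shows "increments_on I (D j) (D (Suc j))"
proof -
  have n0: "n \<noteq> 0" using j by simp
  have top: "increments_on I (D (n - 1)) (D n)"
    unfolding increments_on_def
  proof (intro ballI impI conjI)
    fix v u assume vu: "v \<in> I" "u \<in> I" "v \<le> u"
    have "is_indef_integral I (D (n - 1)) (D n)"
      using D j by (simp add: is_derivs_def)
    then have int: "interval_lebesgue_integrable lborel (ereal v) (ereal u) (D n)"
      and *: "D (n - 1) u = D (n - 1) v + (LBINT w=ereal v..ereal u. D n w)"
      using vu(1,2) unfolding is_indef_integral_def by blast+
    show "set_integrable lborel {v..u} (D n)"
      by (rule set_integrable_Icc_if_interval_integrable[OF vu(3) int])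
    show "(LINT w:{v..u}|lborel. D n w) = D (n - 1) u - D (n - 1) v"
      using * interval_integral_Icc[OF vu(3), of "D n"] by simp
  qed
  show ?thesis
  proof (cases "Suc j = n")
    case True
    then have "D j = D (n - 1)" "D (Suc j) = D n" by auto
    then show ?thesis using top by simp
  next
    case False
    show ?thesis unfolding increments_on_def
    proof (intro ballI impI)
      fix v u assume vu: "v \<in> I" "u \<in> I" "v \<le> u"
      have sub: "{v..u} \<subseteq> I"
        using mem_is_interval_1_I[OF I vu(1,2)] by auto
      have der: "(D i has_real_derivative D (Suc i) x) (at x within I)" if "x \<in> I" "Suc i < n" for i x
        using D that unfolding is_derivs_def if_not_P[OF n0] by blast
      \<comment> \<open>The fundamental theorem needs a continuous derivative.
        \<open>D (Suc j)\<close> is differentiable if \<open>Suc (Suc j) < n\<close>; for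
        \<open>Suc j = n - 1\<close> it is continuous as an indefinite integral of
        \<open>D n\<close>.\<close>
      have cont: "continuous_on {v..u} (D (Suc j))"
      proof (cases "Suc (Suc j) < n")
        case True
        show ?thesis
          by (rule continuous_on_subset[OF DERIV_continuous_on sub]) (rule der[OF _ True])
      next
        case False
        then have "Suc j = n - 1" using j \<open>Suc j \<noteq> n\<close> by linarith
        then have n: "D (Suc j) = D (n - 1)" by simp
        have eq: "D (n - 1) x = D (n - 1) v + integral {v..x} (D n)" if x: "x \<in> {v..u}" for x
        proof -
          have "x \<in> I" "v \<le> x" using x sub by auto
          note inc = increments_onD[OF top vu(1) this]
          from set_borel_integral_eq_integral(2)[OF inc(1)] inc(2) show ?thesis by linarith
        qed
        have "continuous_on {v..u} (\<lambda>x. D (n - 1) v + integral {v..x} (D n))"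
          using set_borel_integral_eq_integral(1)[OF increments_onD(1)[OF top vu]]
          by (intro continuous_intros indefinite_integral_continuous_1)
        then show ?thesis unfolding n by (rule continuous_on_eq) (rule eq[symmetric])
      qed
      have "(LINT w|lborel. indicator {v..u} w *\<^sub>R D (Suc j) w) = D j u - D j v"
      proof (rule integral_FTC_atLeastAtMost[OF vu(3) _ cont])
        fix x assume "v \<le> x" "x \<le> u"
        then have "(D j has_real_derivative D (Suc j) x) (at x within {v..u})"
          by (intro DERIV_subset[OF der sub]) (use j False sub in auto)
        then show "(D j has_vector_derivative D (Suc j) x) (at x within {v..u})"
          by (simp add: has_real_derivative_iff_has_vector_derivative)
      qed
      moreover have "set_integrable lborel {v..u} (D (Suc j))"
        using borel_integrable_atLeastAtMost'[OF cont] .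
      ultimately show "set_integrable lborel {v..u} (D (Suc j)) \<and>
          (LINT w:{v..u}|lborel. D (Suc j) w) = D j u - D j v"
        by (simp add: set_lebesgue_integral_def)
    qed
  qed
qed

text \<open>On \<open>{x - 1..x}\<close> the density is at most \<open>f x\<close>, so
  \<open>F\<close> grows by at most \<open>f x\<close> there, and \<open>F\<close> is
  nondecreasing.\<close>

lemma mono_density_nonneg:
  assumes I: "\<And>x y. x \<in> I \<Longrightarrow> y \<le> x \<Longrightarrow> y \<in> I" and "mono_on I F" "mono_on I f"
    and inc: "increments_on I F f" and x: "x \<in> I"
  shows "0 \<le> f x"
proof -
  have x1: "x - 1 \<in> I" by (rule I[OF x]) simp
  have "increments_on I (\<lambda>w. f x * w) (\<lambda>w. f x)"
    by (rule increments_on_DERIV) (auto intro!: derivative_eq_intros)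
  from increments_on_nonneg[OF increments_on_diff[OF this inc] x x1]
  have "f x * (x - 1) - F (x - 1) \<le> f x * x - F x"
    using mono_onD[OF assms(3) I[OF x] x] by simp
  moreover have "F (x - 1) \<le> F x" using mono_onD[OF assms(2) x1 x] by simp
  ultimately show ?thesis by (simp add: algebra_simps)
qed

lemma F_plus_mixture:
  assumes int: "is_interval I" and I: "\<And>x y. x \<in> I \<Longrightarrow> y \<le> x \<Longrightarrow> y \<in> I" and s: "s \<in> I"
    and k: "1 \<le> k" "k \<le> n + 1" and f: "f \<in> F_plus I k n"
  obtains g a b C where "level_kernel I g" "\<forall>r. a r \<in> borel_measurable borel"
    "0 \<le> C" "k = n + 1 \<longrightarrow> C = 0"
    "mixture_on I s k (\<lambda>l x. level_kernel.ker I g n l x - (\<Sum>r<k. a r l * (x - s) ^ r))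
       (\<lambda>x. f x - ((\<Sum>r<k. b r * (x - s) ^ r) + C * (x - s) ^ k))"
proof -
  obtain D where D: "is_derivs I n f D" and mono: "\<And>j. k - 1 \<le> j \<Longrightarrow> j \<le> n \<Longrightarrow> mono_on I (D j)"
    using f by (auto simp: F_plus_def)
  have inc: "increments_on I (D j) (D (Suc j))" if "j < n" for j
    using is_derivs_increments_on[OF int D that] .
  obtain k' where k': "k = Suc k'" using k by (cases k) auto
  interpret level_kernel I "D n"
  proof
    show "I \<noteq> {}" using s by blast
    show "mono_on I (D n)" using k by (intro mono) simp_all
  qed (rule I)
  \<comment> \<open>The representation at order \<open>k' = k - 1\<close>. If
    \<open>k = n + 1\<close>, this is the layer-cake formula itself. Otherwise \<open>n - k\<close>
    integrations from -\<infinity> lead from \<open>D n\<close> to \<open>D k\<close>, and one from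
    \<open>s\<close> to \<open>D k'\<close>, whose sign is unknown.\<close>
  obtain C where C: "0 \<le> C" "k = n + 1 \<Longrightarrow> C = 0"
    and base: "mixture_on I s 1 (\<lambda>l u. ker (n - k') l u - ker (n - k') l s)
       (\<lambda>u. D k' u - D k' s - C * (u - s))"
  proof (cases "k \<le> n")
    case False
    then have "k' = n" using k k' by simp
    then show ?thesis using that[of 0] mixture_on_ker_0_diff[OF s] by simp
  next
    case True
    \<comment> \<open>\<open>D (n - i)\<close> is a nondecreasing density of its predecessor, which
      has order at least \<open>k - 1\<close> and so is nondecreasing too.\<close>
    have nn: "0 \<le> D (n - i) u" if "i \<le> n - k" "u \<in> I" for i u
    proof -
      obtain j where j: "n - i = Suc j" "k - 1 \<le> j" "j < n"
      proof (rule that)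
        show "n - i = Suc (n - i - 1)" "k - 1 \<le> n - i - 1" "n - i - 1 < n"
          using \<open>i \<le> n - k\<close> True k by auto
      qed
      show ?thesis unfolding j
        by (rule mono_density_nonneg[OF I mono mono inc \<open>u \<in> I\<close>]) (use j in auto)
    qed
    have inc': "increments_on I (D (n - Suc i)) (D (n - i))" if "i < n - k" for i
      using inc[of "n - Suc i"] that by (simp add: Suc_diff_Suc)
    have "\<exists>C\<ge>0. mixture_on I s 0 (ker (n - k)) (\<lambda>u. D (n - (n - k)) u - C)"
      by (rule mixture_on_ker_iterated[of "n - k" "\<lambda>i. D (n - i)", OF inc' _ nn]) simp_all
    then obtain C where C: "0 \<le> C"
      and mix: "mixture_on I s 0 (ker (n - k)) (\<lambda>u. D (n - (n - k)) u - C)"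
      by blast
    have nk: "n - k' = Suc (n - k)" "n - (n - k) = k" using True k' by auto
    have lin: "increments_on I (\<lambda>u. C * u) (\<lambda>u. C)"
      by (rule increments_on_DERIV) (auto intro!: derivative_eq_intros)
    have "mixture_on I s (Suc 0) (\<lambda>l u. ker (Suc (n - k)) l u - ker (Suc (n - k)) l s)
        (\<lambda>u. (D k' u - C * u) - (D k' s - C * s))"
    proof (rule mixture_on_integrate[OF I s _ increments_on_diff[OF _ lin] increments_on_ker measurable_ker])
      show "mixture_on I s 0 (ker (n - k)) (\<lambda>u. D (Suc k') u - C)" using mix[unfolded nk(2)] by (simp only: k')
      show "increments_on I (D k') (D (Suc k'))" using True k' by (intro inc) simp
    qed
    also have "(\<lambda>u. (D k' u - C * u) - (D k' s - C * s)) = (\<lambda>u. D k' u - D k' s - C * (u - s))"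
      by (simp add: fun_eq_iff algebra_simps)
    finally show ?thesis using that[of C] C True unfolding nk by simp
  qed
  have "\<exists>a b. (\<forall>r. a r \<in> borel_measurable borel) \<and>
     mixture_on I s (Suc k') (\<lambda>l u. ker (n - k' + k') l u - (\<Sum>r\<le>k'. a r l * (u - s) ^ r))
       (\<lambda>u. D (k' - k') u - ((\<Sum>r\<le>k'. b r * (u - s) ^ r) + C / fact (Suc k') * (u - s) ^ Suc k'))"
    by (rule mixture_on_taylor[OF inc s base order_refl]) (use k k' in simp)
  then obtain a b where ab: "\<And>r. a r \<in> borel_measurable borel"
    "mixture_on I s (Suc k') (\<lambda>l u. ker (n - k' + k') l u - (\<Sum>r\<le>k'. a r l * (u - s) ^ r))
       (\<lambda>u. D (k' - k') u - ((\<Sum>r\<le>k'. b r * (u - s) ^ r) + C / fact (Suc k') * (u - s) ^ Suc k'))"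
    by blast
  have n: "n - k' + k' = n" using k k' by simp
  have "D 0 u = f u" if "u \<in> I" for u using D that unfolding is_derivs_def by blast
  moreover have "mixture_on I s k (\<lambda>l u. ker n l u - (\<Sum>r<k. a r l * (u - s) ^ r))
       (\<lambda>u. D 0 u - ((\<Sum>r<k. b r * (u - s) ^ r) + C / fact k * (u - s) ^ k))"
    using ab(2) by (simp only: k' lessThan_Suc_atMost n diff_self_eq_0)
  ultimately have mix: "mixture_on I s k (\<lambda>l u. ker n l u - (\<Sum>r<k. a r l * (u - s) ^ r))
       (\<lambda>u. f u - ((\<Sum>r<k. b r * (u - s) ^ r) + C / fact k * (u - s) ^ k))"
    by (simp add: mixture_on_def)
  show ?thesis
  proof (rule that[of "D n" a "C / fact k" b])
    show "level_kernel I (D n)" by (rule level_kernel_axioms)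
    show "0 \<le> C / fact k" using C(1) by simp
    show "k = n + 1 \<longrightarrow> C / fact k = 0" using C(2) by simp
    show "\<forall>r. a r \<in> borel_measurable borel" using ab(1) by blast
  qed (rule mix)
qed

section \<open>Comparison for kernels and polynomials\<close>

lemma measurable_restrict_interval:
  assumes "sets \<nu> = sets (restrict_space borel I)" "f \<in> borel_measurable borel"
  shows "f \<in> borel_measurable \<nu>"
  using measurable_restrict_space1[OF assms(2), of I] measurable_cong_sets[OF assms(1) refl] by blast

lemma int_ge_trunc_power_iff:
  assumes "sets \<nu>1 = sets (restrict_space borel I)" "sets \<nu>2 = sets (restrict_space borel I)"
  shows "ext_integral_ge \<nu>1 \<nu>2 (trunc_power n t) \<longleftrightarrow> int_ge \<nu>1 \<nu>2 (trunc_power n t)"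
proof -
  have "trunc_power n t \<in> borel_measurable borel" by (auto simp: trunc_power_def[abs_def])
  moreover have "ennreal (- trunc_power n t x) = 0" for x by (simp add: trunc_power_def ennreal_neg)
  ultimately show ?thesis
    using assms by (intro ext_integral_ge_iff_int_ge) (auto intro: measurable_restrict_interval)
qed

text \<open>For \<open>n > 0\<close> the kernel is a multiple of the truncated power at
  \<open>jump l\<close>. For \<open>n = 0\<close> it is the indicator of a half-line in
  \<open>I\<close>, closed or open at \<open>jump l\<close>; the open one is a limit.\<close>

lemma (in level_kernel) int_ge_ker:
  assumes sets: "sets \<nu>1 = sets (restrict_space borel I)" "sets \<nu>2 = sets (restrict_space borel I)"
    and ge: "\<And>t. t \<in> I \<Longrightarrow> int_ge \<nu>1 \<nu>2 (trunc_power n t)"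
  shows "int_ge \<nu>1 \<nu>2 (ker n l)"
proof -
  have space: "space \<nu>1 = I" "space \<nu>2 = I"
    using sets[THEN sets_eq_imp_space_eq] by (simp_all add: space_restrict_space)
  consider "l \<notin> levels" | "l \<in> levels" "n > 0" | "l \<in> levels" "n = 0" "l \<le> g (jump l)"
    | "l \<in> levels" "n = 0" "g (jump l) < l" by fastforce
  then show ?thesis
  proof cases
    case 1
    then have "ker n l = (\<lambda>x. 0)" by (simp add: ker_def fun_eq_iff)
    then show ?thesis by (simp add: int_ge_def)
  next
    case 2
    have "int_ge \<nu>1 \<nu>2 (\<lambda>x. (1 / fact n) * trunc_power n (jump l) x)"
      by (intro int_ge_cmult ge jump_in 2) simp
    then show ?thesis using 2 by (simp add: ker_def[abs_def] trunc_power_def)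
  next
    case 3
    have "l \<le> g x \<longleftrightarrow> jump l \<le> x" if "x \<in> I" for x
      using mono_onD[OF mono_g jump_in[OF 3(1)] that] jump_le[OF 3(1) that] 3 by auto
    then show ?thesis
      by (intro int_ge_cong[OF space _ ge[OF jump_in[OF 3(1)]]]) (use 3 in \<open>auto simp: trunc_power_def ker_def\<close>)
  next
    case 4
    \<comment> \<open>The superlevel set is open at \<open>jump l\<close>, hence an increasing union of closed ones.\<close>
    obtain y where y: "y \<in> I" "l \<le> g y" using 4(1) by (auto simp: levels_def)
    have jy: "jump l < y" using jump_le[OF 4(1) y] y 4 by (auto simp: less_le)
    \<comment> \<open>The sequence starts at \<open>y\<close>, hence stays in \<open>I\<close>, and
      decreases strictly to \<open>jump l\<close>.\<close>
    define t where "t = (\<lambda>i. jump l + (y - jump l) / real (Suc i))"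
    have t: "t i \<in> I" for i
    proof (rule down_closed[OF y(1)])
      have "(y - jump l) / real (Suc i) \<le> (y - jump l) / 1"
        by (rule divide_left_mono) (use jy in auto)
      then show "t i \<le> y" by (simp add: t_def)
    qed
    have t_dec: "t j \<le> t i" if "i \<le> j" for i j
      using that jy by (simp add: t_def frac_le)
    have lim: "t \<longlonglongrightarrow> jump l"
      unfolding t_def by (rule tendsto_eq_intros LIMSEQ_Suc[OF lim_const_over_n] | simp)+
    have sup: "(SUP i. ennreal (trunc_power 0 (t i) x)) = ennreal (ker 0 l x)" if x: "x \<in> I" for x
    proof (cases "jump l < x")
      case True
      then obtain i where i: "t i < x"
        using eventually_happens'[OF sequentially_bot order_tendstoD(2)[OF lim]] by blast
      have "ker 0 l x = 1" using level_le_if_jump_less[OF 4(1) x True] 4 x by (simp add: ker_def)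
      moreover have "(SUP i. ennreal (trunc_power 0 (t i) x)) = 1"
      proof (rule antisym)
        show "(SUP i. ennreal (trunc_power 0 (t i) x)) \<le> 1"
          by (rule SUP_least) (simp add: trunc_power_def)
        show "1 \<le> (SUP i. ennreal (trunc_power 0 (t i) x))"
          by (rule SUP_upper2[of i]) (use i in \<open>simp_all add: trunc_power_def\<close>)
      qed
      ultimately show ?thesis by simp
    next
      case False
      have "x < t i" for i
        using jy False by (intro le_less_trans[of x "jump l"]) (simp_all add: t_def)
      then have "trunc_power 0 (t i) x = 0" for i
        by (simp add: trunc_power_def not_le)
      moreover have "ker 0 l x = 0"
        using jump_le[OF 4(1) x] False 4 by (auto simp: ker_def)
      ultimately show ?thesis by simp
    qed
    have eq: "(\<integral>\<^sup>+x. ennreal (ker 0 l x) \<partial>\<nu>) = (SUP i. \<integral>\<^sup>+x. ennreal (trunc_power 0 (t i) x) \<partial>\<nu>)"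
      if sp: "space \<nu> = I" and "\<And>i. trunc_power 0 (t i) \<in> borel_measurable \<nu>" for \<nu>
    proof -
      have "(\<integral>\<^sup>+x. ennreal (ker 0 l x) \<partial>\<nu>) = (\<integral>\<^sup>+x. (SUP i. ennreal (trunc_power 0 (t i) x)) \<partial>\<nu>)"
        using sup sp by (intro nn_integral_cong) simp
      also have "\<dots> = (SUP i. \<integral>\<^sup>+x. ennreal (trunc_power 0 (t i) x) \<partial>\<nu>)"
      proof (rule nn_integral_monotone_convergence_SUP)
        show "incseq (\<lambda>i x. ennreal (trunc_power 0 (t i) x))"
          using order_trans[OF t_dec] by (auto simp: incseq_def le_fun_def trunc_power_def)
      qed (use that in auto)
      finally show ?thesis .
    qed
    have neg: "ennreal (- trunc_power 0 u x) = 0" "ennreal (- ker 0 l x) = 0" for u x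
      using ker_nonneg[of 0 l x] by (simp_all add: trunc_power_def ennreal_neg)
    have "ker 0 l \<in> borel_measurable borel" by measurable
    then have m: "ker 0 l \<in> borel_measurable \<nu>1" "ker 0 l \<in> borel_measurable \<nu>2"
      using sets by (auto intro: measurable_restrict_interval)
    have ge0: "int_ge \<nu>1 \<nu>2 (trunc_power 0 (t i))" for i using ge[OF t] 4(2) by simp
    then have mt: "trunc_power 0 (t i) \<in> borel_measurable \<nu>1" "trunc_power 0 (t i) \<in> borel_measurable \<nu>2"
      and le: "(\<integral>\<^sup>+x. ennreal (trunc_power 0 (t i) x) \<partial>\<nu>2) \<le> (\<integral>\<^sup>+x. ennreal (trunc_power 0 (t i) x) \<partial>\<nu>1)" for i
      by (simp_all add: int_ge_def neg)
    have "(\<integral>\<^sup>+x. ennreal (ker 0 l x) \<partial>\<nu>2) \<le> (\<integral>\<^sup>+x. ennreal (ker 0 l x) \<partial>\<nu>1)"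
      unfolding eq[OF space(1) mt(1)] eq[OF space(2) mt(2)] by (rule SUP_mono) (use le in blast)
    with m show ?thesis unfolding 4(2) by (simp add: int_ge_def neg)
  qed
qed

lemma degree_less_poly_eq_sum:
  fixes p :: "real poly"
  assumes "degree p < k"
  shows "\<exists>e. \<forall>x. poly p x = (\<Sum>i<k. e i * (x - s) ^ i)"
proof -
  define q where "q = pcompose p [:s, 1:]"
  have "degree q < k" using assms by (simp add: q_def degree_pcompose)
  have "poly p x = (\<Sum>i<k. coeff q i * (x - s) ^ i)" for x
  proof -
    have "poly p x = poly q (x - s)" by (simp add: q_def poly_pcompose)
    also have "\<dots> = (\<Sum>i\<le>degree q. coeff q i * (x - s) ^ i)" by (rule poly_altdef)
    also have "\<dots> = (\<Sum>i<k. coeff q i * (x - s) ^ i)"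
      using \<open>degree q < k\<close> by (intro sum.mono_neutral_left) (auto simp: coeff_eq_0)
    finally show ?thesis .
  qed
  then show ?thesis by blast
qed

text \<open>Removing \<open>coeff p k * (x - z) ^ k\<close> leaves degree below \<open>k\<close>,
  which is expanded about \<open>s\<close>. The hypotheses for both signs of the low powers allow
  arbitrary coefficients there.\<close>

lemma int_ge_poly:
  assumes k: "1 \<le> k"
    and low: "\<And>i. i < k \<Longrightarrow> int_ge \<nu>1 \<nu>2 (\<lambda>x. (x - s) ^ i)" "\<And>i. i < k \<Longrightarrow> int_ge \<nu>1 \<nu>2 (\<lambda>x. - ((x - s) ^ i))"
    and top: "coeff p k \<noteq> 0 \<Longrightarrow> int_ge \<nu>1 \<nu>2 (\<lambda>x. (x - z) ^ k)"
    and p: "degree p \<le> k" "0 \<le> coeff p k"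
  shows "int_ge \<nu>1 \<nu>2 (poly p)"
proof -
  define q where "q = p - smult (coeff p k) ([:- z, 1:] ^ k)"
  have "coeff q k = 0" by (simp add: q_def coeff_linear_power)
  moreover have "degree q \<le> k"
    unfolding q_def by (intro degree_diff_le p order_trans[OF degree_smult_le]) (simp add: degree_linear_power)
  ultimately have "degree q < k"
    using k by (cases "degree q = k") (auto simp: less_le)
  then obtain e where e: "\<And>x. poly q x = (\<Sum>i<k. e i * (x - s) ^ i)"
    using degree_less_poly_eq_sum by blast
  have "int_ge \<nu>1 \<nu>2 (\<lambda>x. e i * (x - s) ^ i)" if "i < k" for i
    using int_ge_cmult[OF low(1)[OF that], of "e i"] int_ge_cmult[OF low(2)[OF that], of "- e i"]
    by (cases "0 \<le> e i") auto
  then have "int_ge \<nu>1 \<nu>2 (poly q)" unfolding e[abs_def] by (intro int_ge_sum) auto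
  moreover have "int_ge \<nu>1 \<nu>2 (\<lambda>x. coeff p k * (x - z) ^ k)"
  proof (cases "coeff p k = 0")
    case True
    then show ?thesis by (simp add: int_ge_def)
  next
    case False
    then show ?thesis using top p by (intro int_ge_cmult) auto
  qed
  ultimately have "int_ge \<nu>1 \<nu>2 (\<lambda>x. poly q x + coeff p k * (x - z) ^ k)" by (rule int_ge_add)
  moreover have "poly q x + coeff p k * (x - z) ^ k = poly p x" for x by (simp add: q_def)
  ultimately show ?thesis by simp
qed

subsection \<open>Integral inequalities over the class\<close>

lemma int_ge_F_plus:
  assumes I: "is_interval I" "\<And>x y. x \<in> I \<Longrightarrow> y \<le> x \<Longrightarrow> y \<in> I" and s: "s \<in> I"
    and k: "1 \<le> k" "k \<le> n + 1" and f: "f \<in> F_plus I k n"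
    and sets: "sets \<nu>1 = sets (restrict_space borel I)" "sets \<nu>2 = sets (restrict_space borel I)"
    and poly: "\<And>p. degree p \<le> k \<Longrightarrow> 0 \<le> coeff p k \<Longrightarrow> (k = n + 1 \<Longrightarrow> coeff p k = 0) \<Longrightarrow> int_ge \<nu>1 \<nu>2 (poly p)"
    and tr: "\<And>t. t \<in> I \<Longrightarrow> int_ge \<nu>1 \<nu>2 (trunc_power n t)"
    and neg: "(\<integral>\<^sup>+x. ennreal (- f x) \<partial>\<nu>1) < \<infinity>" "(\<integral>\<^sup>+x. ennreal (- f x) \<partial>\<nu>2) < \<infinity>"
  shows "int_ge \<nu>1 \<nu>2 f"
proof -
  obtain g a b C where "level_kernel I g" and a: "\<forall>r. a r \<in> borel_measurable borel"
    and C: "0 \<le> C" "k = n + 1 \<longrightarrow> C = 0"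
    and mix: "mixture_on I s k (\<lambda>l x. level_kernel.ker I g n l x - (\<Sum>r<k. a r l * (x - s) ^ r))
       (\<lambda>x. f x - ((\<Sum>r<k. b r * (x - s) ^ r) + C * (x - s) ^ k))"
    by (rule F_plus_mixture[OF I s k f]) blast
  then interpret level_kernel I g by blast
  have space: "space \<nu>1 = I" "space \<nu>2 = I"
    using sets[THEN sets_eq_imp_space_eq] by (simp_all add: space_restrict_space)
  have P: "int_ge \<nu>1 \<nu>2 (\<lambda>x. (\<Sum>r<k. c r * (x - s) ^ r) + c' * (x - s) ^ k)"
    if c': "0 \<le> c'" "k = n + 1 \<Longrightarrow> c' = 0" for c :: "nat \<Rightarrow> real" and c'
  proof -
    define p where "p = (\<Sum>r<k. smult (c r) ([:- s, 1:] ^ r)) + smult c' ([:- s, 1:] ^ k)"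
    have "degree (smult u ([:- s, 1:] ^ r)) \<le> k" if "r \<le> k" for u r
      using degree_smult_le[of u "[:- s, 1:] ^ r"] that by (simp add: degree_linear_power)
    then have "degree p \<le> k"
      unfolding p_def by (intro degree_add_le degree_sum_le) auto
    moreover have "coeff ([:- s, 1:] ^ r) k = 0" if "r < k" for r
      using that by (intro coeff_eq_0) (simp add: degree_linear_power)
    then have "coeff p k = c'"
      by (simp add: p_def coeff_sum coeff_linear_power)
    ultimately have "int_ge \<nu>1 \<nu>2 (poly p)" using c' by (intro poly) auto
    moreover have "poly p = (\<lambda>x. (\<Sum>r<k. c r * (x - s) ^ r) + c' * (x - s) ^ k)"
      by (simp add: p_def fun_eq_iff poly_sum)
    ultimately show ?thesis by simp
  qed
  have P0: "int_ge \<nu>1 \<nu>2 (\<lambda>x. \<Sum>r<k. c r * (x - s) ^ r)" for c using P[of 0 c] by simp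
  \<comment> \<open>The constant -1 is an admissible polynomial since \<open>k \<ge> 1\<close>; its
    negative part has finite integral, so both measures are finite and Tonelli applies.\<close>
  have fin: "sigma_finite_measure \<nu>" if "\<nu> = \<nu>1 \<or> \<nu> = \<nu>2" for \<nu>
  proof -
    have "int_ge \<nu>1 \<nu>2 (poly [:- 1:])"
      using k by (intro poly) (simp_all add: coeff_pCons split: nat.split)
    then have "(\<integral>\<^sup>+x. ennreal 1 \<partial>\<nu>) < \<infinity>"
      using that unfolding int_ge_def by auto
    then have "finite_measure \<nu>" by (intro finite_measureI) (simp add: less_top)
    then show ?thesis by (simp add: finite_measure_def)
  qed
  define H where "H = (\<lambda>l x. ker n l x - (\<Sum>r<k. a r l * (x - s) ^ r))"
  have Hb: "case_prod H \<in> borel_measurable (borel \<Otimes>\<^sub>M borel)"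
    and int: "\<And>x. x \<in> I \<Longrightarrow> integrable lborel (\<lambda>l. H l x)"
    and val: "\<And>x. x \<in> I \<Longrightarrow> (LINT l|lborel. H l x) = f x - ((\<Sum>r<k. b r * (x - s) ^ r) + C * (x - s) ^ k)"
    and sgn: "\<And>x l. x \<in> I \<Longrightarrow> s \<le> x \<Longrightarrow> 0 \<le> H l x" "\<And>x l. x \<in> I \<Longrightarrow> x \<le> s \<Longrightarrow> 0 \<le> (-1) ^ k * H l x"
    using mix unfolding mixture_on_def H_def by blast+
  have H: "case_prod H \<in> borel_measurable (lborel \<Otimes>\<^sub>M \<nu>)"
    if "sets \<nu> = sets (restrict_space borel I)" for \<nu>
  proof -
    have [measurable]: "(\<lambda>x. x) \<in> measurable \<nu> borel" by (rule measurable_restrict_interval[OF that]) simp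
    have "(\<lambda>p. (fst p, snd p)) \<in> measurable (lborel \<Otimes>\<^sub>M \<nu>) (borel \<Otimes>\<^sub>M borel)" by measurable
    from measurable_compose[OF this Hb] show ?thesis by simp
  qed
  let ?h = "\<lambda>x. LINT l|lborel. H l x" and ?T = "\<lambda>x. (\<Sum>r<k. b r * (x - s) ^ r) + C * (x - s) ^ k"
  have "(\<lambda>(x, l). H l x) \<in> borel_measurable (borel \<Otimes>\<^sub>M lborel)"
    using measurable_pair_swap[OF Hb]
    by (simp add: measurable_cong_sets[OF sets_pair_measure_cong[OF refl sets_lborel] refl])
  then have hm: "?h \<in> borel_measurable borel" by (intro lborel.borel_measurable_lebesgue_integral) simp
  \<comment> \<open>The term \<open>C * (x - s) ^ k\<close> may fail to be integrable, so it cannot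
    simply be subtracted from \<open>f\<close>. But \<open>?h x < 0\<close> forces
    \<open>x < s\<close> and odd \<open>k\<close>; there this term is nonpositive, and
    \<open>- ?h\<close> is bounded by \<open>- f\<close> plus a polynomial of degree below
    \<open>k\<close>.\<close>
  have negh: "(\<integral>\<^sup>+x. ennreal (- ?h x) \<partial>\<nu>) < \<infinity>"
    if sets: "sets \<nu> = sets (restrict_space borel I)" and negf: "(\<integral>\<^sup>+x. ennreal (- f x) \<partial>\<nu>) < \<infinity>"
      and \<nu>: "\<nu> = \<nu>1 \<or> \<nu> = \<nu>2" for \<nu>
  proof -
    let ?Q = "\<lambda>x. \<Sum>r<k. - b r * (x - s) ^ r"
    have spc: "space \<nu> = I" using sets[THEN sets_eq_imp_space_eq] by (simp add: space_restrict_space)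
    have "(\<lambda>x. ?h x + ?T x) \<in> borel_measurable borel" using hm by (intro borel_measurable_add) auto
    then have "(\<lambda>x. ?h x + ?T x) \<in> borel_measurable \<nu>" by (rule measurable_restrict_interval[OF sets])
    then have fm: "f \<in> borel_measurable \<nu>"
      by (rule measurable_cong[THEN iffD1, rotated]) (simp add: spc val)
    have Q: "?Q \<in> borel_measurable \<nu>" "(\<integral>\<^sup>+x. ennreal (- ?Q x) \<partial>\<nu>) < \<infinity>"
      using P0[of "\<lambda>r. - b r"] \<nu> by (auto simp only: int_ge_def)
    have "(\<integral>\<^sup>+x. ennreal (- ?h x) \<partial>\<nu>) \<le> (\<integral>\<^sup>+x. ennreal (- (f x + ?Q x)) \<partial>\<nu>)"
    proof (rule nn_integral_mono)
      fix x assume "x \<in> space \<nu>"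
      then have x: "x \<in> I" by (simp add: spc)
      show "ennreal (- ?h x) \<le> ennreal (- (f x + ?Q x))"
      proof (cases "0 \<le> ?h x")
        case True
        then show ?thesis by (simp add: ennreal_neg)
      next
        case False
        have xs: "x < s"
        proof (rule ccontr)
          assume "\<not> x < s"
          then have "0 \<le> ?h x" using sgn(1)[OF x] by (intro integral_nonneg_AE AE_I2) simp
          with False show False by simp
        qed
        have "odd k"
        proof
          assume "even k"
          then have "0 \<le> ?h x" using sgn(2)[OF x] xs by (intro integral_nonneg_AE AE_I2) simp
          with False show False by simp
        qed
        then have "C * (x - s) ^ k \<le> 0" using C(1) xs by (intro mult_nonneg_nonpos) (simp_all add: power_le_zero_eq odd_pos)
        then show ?thesis by (intro ennreal_leI) (simp add: val[OF x] sum_negf)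
      qed
    qed
    also have "\<dots> \<le> (\<integral>\<^sup>+x. ennreal (- f x) \<partial>\<nu>) + (\<integral>\<^sup>+x. ennreal (- ?Q x) \<partial>\<nu>)"
      by (rule neg_part_add_le[OF fm Q(1)])
    also have "\<dots> < \<infinity>" using negf Q(2) by simp
    finally show ?thesis .
  qed
  have "int_ge \<nu>1 \<nu>2 ?h"
  proof (rule int_ge_mixture[OF _ _ space H[OF sets(1)] H[OF sets(2)] int])
    show "(\<forall>l. 0 \<le> H l x) \<or> (\<forall>l. H l x \<le> 0)" if "x \<in> I" for x
      using sgn[OF that] by (cases "s \<le> x"; cases "even k") auto
    show "int_ge \<nu>1 \<nu>2 (H l)" for l
      using int_ge_add[OF int_ge_ker[OF sets tr] P0[of "\<lambda>r. - a r l"]]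
      by (simp add: H_def sum_negf)
  qed (use fin negh sets neg in auto)
  then have ge: "int_ge \<nu>1 \<nu>2 (\<lambda>x. ?h x + ?T x)" by (intro int_ge_add P C(1) C(2)[rule_format])
  have eq: "?h x + ?T x = f x" if "x \<in> I" for x using val[OF that] by simp
  show ?thesis by (rule int_ge_cong[OF space _ ge]) (rule eq)
qed

text \<open>The comparisons of \<open>f\<close> and of \<open>- f\<close> together make both parts
  finite under both measures, and give the two opposite inequalities.\<close>

lemma ext_integral_eq_finite_iff_int_ge:
  assumes "f \<in> borel_measurable \<nu>1" "f \<in> borel_measurable \<nu>2"
  shows "ext_integral_eq_finite \<nu>1 \<nu>2 f \<longleftrightarrow> int_ge \<nu>1 \<nu>2 f \<and> int_ge \<nu>1 \<nu>2 (\<lambda>x. - f x)"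
proof
  assume eq: "ext_integral_eq_finite \<nu>1 \<nu>2 f"
  have fin: "(\<integral>\<^sup>+x. ennreal (f x) \<partial>\<nu>) < \<infinity>" "(\<integral>\<^sup>+x. ennreal (- f x) \<partial>\<nu>) < \<infinity>"
    if "\<nu> = \<nu>1 \<or> \<nu> = \<nu>2" for \<nu>
  proof -
    have *: "ext_integral_exists \<nu> f" "\<bar>ext_integral \<nu> f\<bar> \<noteq> \<infinity>"
      using eq that unfolding ext_integral_eq_finite_def by (metis (no_types))+
    then have "ext_integral \<nu> f > -\<infinity>" "ext_integral \<nu> f < \<infinity>"
      by (cases "ext_integral \<nu> f"; simp)+
    with * show "(\<integral>\<^sup>+x. ennreal (f x) \<partial>\<nu>) < \<infinity>" "(\<integral>\<^sup>+x. ennreal (- f x) \<partial>\<nu>) < \<infinity>"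
      using pos_part_finite_if_ext_integral neg_part_finite_if_ext_integral by blast+
  qed
  have "ext_integral_ge \<nu>1 \<nu>2 f"
    using eq by (simp add: ext_integral_eq_finite_def ext_integral_ge_def)
  then have 1: "int_ge \<nu>1 \<nu>2 f"
    using fin assms by (subst (asm) ext_integral_ge_iff_int_ge) blast+
  have "ext_integral_ge \<nu>2 \<nu>1 f"
    using eq by (simp add: ext_integral_eq_finite_def ext_integral_ge_def)
  then have "int_ge \<nu>2 \<nu>1 f"
    using fin assms by (subst (asm) ext_integral_ge_iff_int_ge) blast+
  then have "int_ge \<nu>1 \<nu>2 (\<lambda>x. - f x)"
    using fin[of \<nu>1] fin[of \<nu>2] by (auto simp: int_ge_def add.commute)
  with 1 show "int_ge \<nu>1 \<nu>2 f \<and> int_ge \<nu>1 \<nu>2 (\<lambda>x. - f x)" by blast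
next
  assume ge: "int_ge \<nu>1 \<nu>2 f \<and> int_ge \<nu>1 \<nu>2 (\<lambda>x. - f x)"
  then have "ext_integral_ge \<nu>1 \<nu>2 f"
    using assms by (subst ext_integral_ge_iff_int_ge) (auto simp: int_ge_def)
  moreover have "int_ge \<nu>2 \<nu>1 f"
    using ge by (auto simp: int_ge_def add.commute)
  then have "ext_integral_ge \<nu>2 \<nu>1 f"
    using assms by (subst ext_integral_ge_iff_int_ge) (auto simp: int_ge_def)
  moreover have "\<bar>ext_integral \<nu>1 f\<bar> \<noteq> \<infinity>"
  proof -
    have "(\<integral>\<^sup>+x. ennreal (f x) \<partial>\<nu>1) < \<infinity>" "(\<integral>\<^sup>+x. ennreal (- f x) \<partial>\<nu>1) < \<infinity>"
      using ge by (auto simp: int_ge_def)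
    then show ?thesis unfolding ext_integral_def
      by (cases "\<integral>\<^sup>+x. ennreal (f x) \<partial>\<nu>1"; cases "\<integral>\<^sup>+x. ennreal (- f x) \<partial>\<nu>1")
         (auto simp: enn2ereal_ennreal)
  qed
  ultimately show "ext_integral_eq_finite \<nu>1 \<nu>2 f"
    by (auto simp: ext_integral_eq_finite_def ext_integral_ge_def)
qed

section \<open>Characterization by moments and truncated powers\<close>

theorem corollary5p6:
  fixes I :: "real set" and k n :: nat and G :: "(real \<Rightarrow> real) set"
    and \<nu>1 \<nu>2 :: "real measure" and s z :: real
  assumes "is_interval I" and "\<exists>x\<in>I. \<exists>y\<in>I. x < y"
    and "(INF x\<in>I. ereal x) = -\<infinity>"
    and "1 \<le> k" and "k \<le> n + 1"
    and "P_plus I k n \<union> P0_plus I n \<subseteq> G" and "G \<subseteq> F_plus I k n"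
    and "(\<nu>1, \<nu>2) \<in> N_plus_of I G \<times> N_plus_of I G"
  shows "(\<nu>1, \<nu>2) \<in> hat I G \<longleftrightarrow>
           (\<forall>i\<in>{0..k - 1}. ext_integral_eq_finite \<nu>1 \<nu>2 (\<lambda>x. (x - s) ^ i)) \<and>
           (k \<le> n \<longrightarrow> ext_integral_ge \<nu>1 \<nu>2 (\<lambda>x. (x - z) ^ k)) \<and>
           (\<forall>t\<in>I. ext_integral_ge \<nu>1 \<nu>2 (trunc_power n t))"
proof -
  have down: "y \<in> I" if "x \<in> I" "y \<le> x" for x y
  proof -
    have "(INF x\<in>I. ereal x) < ereal y" using assms(3) by simp
    then obtain w where "w \<in> I" "w < y" by (auto simp: INF_less_iff)
    then show ?thesis using mem_is_interval_1_I[OF assms(1) _ that(1)] that(2) by auto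
  qed
  have sets: "sets \<nu>1 = sets (restrict_space borel I)" "sets \<nu>2 = sets (restrict_space borel I)"
    using assms(8) by (auto simp: N_plus_of_def N_plus_def)
  have space: "space \<nu>1 = I" "space \<nu>2 = I"
    using sets[THEN sets_eq_imp_space_eq] by (simp_all add: space_restrict_space)
  have neg: "(\<integral>\<^sup>+x. ennreal (- f x) \<partial>\<nu>1) < \<infinity>" "(\<integral>\<^sup>+x. ennreal (- f x) \<partial>\<nu>2) < \<infinity>" if "f \<in> G" for f
    using assms(8) that unfolding N_plus_of_def
    by (blast intro: neg_part_finite_if_ext_integral)+
  have pm: "f \<in> borel_measurable \<nu>1" "f \<in> borel_measurable \<nu>2" if "continuous_on UNIV f" for f
    using sets borel_measurable_continuous_onI[OF that] by (auto intro: measurable_restrict_interval)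
  have hat_iff: "(\<nu>1, \<nu>2) \<in> hat I G \<longleftrightarrow> (\<forall>f\<in>G. ext_integral_ge \<nu>1 \<nu>2 f)"
    using assms(8) by (simp add: hat_def)
  \<comment> \<open>Powers below \<open>k\<close> lie in \<open>G\<close> with either sign, which
    gives equality in (i); the power \<open>k\<close> only with a nonnegative factor, which gives
    the inequality (ii). Membership also supplies the finite negative parts for
    \<open>pow_iff\<close>.\<close>
  have pow_G: "restrict (\<lambda>x. c * (x - r) ^ i) I \<in> G" if "i \<le> n" "i \<le> k" "0 \<le> c \<or> i < k" for c r :: real and i
  proof -
    let ?p = "smult c ([:- r, 1:] ^ i)"
    have deg: "degree ?p \<le> i" using degree_smult_le[of c "[:- r, 1:] ^ i"] by (simp add: degree_linear_power)
    have "0 \<le> coeff ?p k"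
    proof (cases "i = k")
      case True
      then show ?thesis using that by (simp add: coeff_linear_power)
    next
      case False
      then show ?thesis using that by (simp add: coeff_eq_0 degree_linear_power)
    qed
    then have "restrict (poly ?p) I \<in> P_plus I k n"
      by (intro poly_in_P_plus assms(4)) (use deg that in auto)
    moreover have "poly ?p = (\<lambda>x. c * (x - r) ^ i)" by (simp add: fun_eq_iff)
    ultimately show ?thesis using assms(6) by auto
  qed
  have neg_cong: "(\<integral>\<^sup>+x. ennreal (- restrict f I x) \<partial>\<nu>1) = (\<integral>\<^sup>+x. ennreal (- f x) \<partial>\<nu>1)"
    "(\<integral>\<^sup>+x. ennreal (- restrict f I x) \<partial>\<nu>2) = (\<integral>\<^sup>+x. ennreal (- f x) \<partial>\<nu>2)" for f
    by (auto intro!: nn_integral_cong simp: space)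
  have pow_iff: "ext_integral_ge \<nu>1 \<nu>2 (\<lambda>x. c * (x - r) ^ i) \<longleftrightarrow> int_ge \<nu>1 \<nu>2 (\<lambda>x. c * (x - r) ^ i)"
    if "i \<le> n" "i \<le> k" "0 \<le> c \<or> i < k" for c r :: real and i
    using neg[OF pow_G[OF that, of r], unfolded neg_cong]
    by (intro ext_integral_ge_iff_int_ge pm continuous_intros)
  have ge_restrict: "ext_integral_ge \<nu>1 \<nu>2 (restrict f I) \<longleftrightarrow> ext_integral_ge \<nu>1 \<nu>2 f" for f
    using ext_integral_cong[of \<nu>1 "restrict f I" f] ext_integral_cong[of \<nu>2 "restrict f I" f]
    by (simp add: ext_integral_ge_def space)
  show ?thesis (is "_ \<longleftrightarrow> ?i \<and> ?ii \<and> ?iii")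
  proof
    assume "(\<nu>1, \<nu>2) \<in> hat I G"
    then have hat: "ext_integral_ge \<nu>1 \<nu>2 f" if "f \<in> G" for f using that by (simp add: hat_iff)
    have pow: "int_ge \<nu>1 \<nu>2 (\<lambda>x. c * (x - r) ^ i)"
      if "i \<le> n" "i \<le> k" "0 \<le> c \<or> i < k" for c r :: real and i
      using hat[OF pow_G[OF that, of r]] pow_iff[OF that] by (simp add: ge_restrict)
    have "ext_integral_eq_finite \<nu>1 \<nu>2 (\<lambda>x. (x - s) ^ i)" if "i \<in> {0..k - 1}" for i
    proof -
      have "i \<le> n" "i < k" using that assms(4,5) by auto
      then show ?thesis
        using pow[of i 1 s] pow[of i "-1" s]
        by (subst ext_integral_eq_finite_iff_int_ge) (auto intro!: pm continuous_intros)
    qed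
    moreover have "ext_integral_ge \<nu>1 \<nu>2 (\<lambda>x. (x - z) ^ k)" if "k \<le> n"
      using pow[of k 1 z] pow_iff[of k 1 z] that by simp
    moreover have "ext_integral_ge \<nu>1 \<nu>2 (trunc_power n t)" if "t \<in> I" for t
    proof -
      have "restrict (\<lambda>x. trunc_power n t x / fact n) I \<in> G"
        using assms(6) that by (auto simp: P0_plus_def)
      from hat[OF this] have "ext_integral_ge \<nu>1 \<nu>2 (\<lambda>x. trunc_power n t x / fact n)"
        by (simp only: ge_restrict)
      moreover have "(\<lambda>x. trunc_power n t x / fact n) \<in> borel_measurable borel"
        by (auto simp: trunc_power_def)
      moreover have "ennreal (- (trunc_power n t x / fact n)) = 0" for x
        by (simp add: trunc_power_def ennreal_neg)
      ultimately have "int_ge \<nu>1 \<nu>2 (\<lambda>x. trunc_power n t x / fact n)"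
        using sets
        by (subst (asm) ext_integral_ge_iff_int_ge) (auto intro: measurable_restrict_interval)
      from int_ge_cmult[OF this, of "fact n"] show ?thesis
        by (simp add: int_ge_trunc_power_iff[OF sets])
    qed
    ultimately show "?i \<and> ?ii \<and> ?iii" by blast
  next
    assume *: "?i \<and> ?ii \<and> ?iii"
    have low: "int_ge \<nu>1 \<nu>2 (\<lambda>x. (x - s) ^ i)" "int_ge \<nu>1 \<nu>2 (\<lambda>x. - ((x - s) ^ i))" if "i < k" for i
    proof -
      have "ext_integral_eq_finite \<nu>1 \<nu>2 (\<lambda>x. (x - s) ^ i)" using * that by auto
      then show "int_ge \<nu>1 \<nu>2 (\<lambda>x. (x - s) ^ i)" "int_ge \<nu>1 \<nu>2 (\<lambda>x. - ((x - s) ^ i))"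
        by (subst (asm) ext_integral_eq_finite_iff_int_ge; auto intro!: pm continuous_intros)+
    qed
    have top: "int_ge \<nu>1 \<nu>2 (\<lambda>x. (x - z) ^ k)" if "k \<le> n"
      using * that pow_iff[of k 1 z] by simp
    have poly: "int_ge \<nu>1 \<nu>2 (poly p)"
      if "degree p \<le> k" "0 \<le> coeff p k" "k = n + 1 \<Longrightarrow> coeff p k = 0" for p
    proof (rule int_ge_poly[OF assms(4) low top that(1,2)])
      show "k \<le> n" if "coeff p k \<noteq> 0"
        using that \<open>k = n + 1 \<Longrightarrow> coeff p k = 0\<close> assms(5) by (cases "k = n + 1") auto
    qed
    have tr: "int_ge \<nu>1 \<nu>2 (trunc_power n t)" if "t \<in> I" for t
      using * that int_ge_trunc_power_iff[OF sets] by blast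
    \<comment> \<open>The base point of the representation must lie in \<open>I\<close>, whereas the
      given \<open>s\<close> is an arbitrary real.\<close>
    obtain s0 where s0: "s0 \<in> I" using assms(2) by blast
    show "(\<nu>1, \<nu>2) \<in> hat I G"
      unfolding hat_iff
    proof
      fix f assume f: "f \<in> G"
      then have "int_ge \<nu>1 \<nu>2 f"
        by (intro int_ge_F_plus[OF assms(1) down s0 assms(4,5) _ sets poly tr] neg) (use assms(7) in auto)
      then show "ext_integral_ge \<nu>1 \<nu>2 f"
        by (subst ext_integral_ge_iff_int_ge) (auto simp: int_ge_def)
    qed
  qed
qed

end
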